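(* Consider the polling system with $K$ queues and an $I$-stage polling table operating under the binomial-exhaustive policy with parameter $\mathbf r\in\mathcal R$, as described in the context. Let $q_k(a_i):=\mathbb E[Q_k(A_i)]$ for $k\in\mathcal K$, $i\in\mathcal I$. Then $(q_k(a_i),\ k\in\mathcal K,\ i\in\mathcal I)$ is the unique solution to the following system of $IK$ equations: $$q_k(a_{i+1})=s_i\lambda_k+(1-r_i)\,q_k(a_i)\quad\text{if }k=p(i),$$ $$q_k(a_{i+1})=s_i\lambda_k+q_k(a_i)+q_{p(i)}(a_i)\,r_i\,\lambda_k\,\frac{1}{\mu_{p(i)}(1-\rho_{p(i)})}\quad\text{if }k\neq p(i),$$ for $k\in\mathcal K$, $i\in\mathcal I$, where the stage index $I+1$ is identified with $1$.
   Context: Model. A single server attends $K$ queues, indexed by $\mathcal K=\{1,\dots,K\}$. Customers arrive at queue $k$ according to a Poisson process with rate $\lambda_k>0$ and wait in an infinite buffer. Service times at queue $k$ are i.i.d., distributed as a nonnegative random variable $S_k$ with mean $1/\mu_k<\infty$. The server visits queues according to a polling table with $I\ge K$ stages, $\mathcal I=\{1,\dots,I\}$; $p:\mathcal I\to\mathcal K$ maps a stage to the queue visited at that stage. Stages are visited cyclically $1,2,\dots,I,1,2,\dots$. Each transition from stage $i$ to the next stage (stage $I+1$ meaning stage $1$) incurs a switchover time distributed as a nonnegative random variable $V_i$ with finite mean $s_i$; $s:=\sum_{i\in\mathcal I}s_i>0$. All arrival processes, service times and switchover times are mutually independent. Put $\rho_k:=\lambda_k/\mu_k$, $\rho:=\sum_{k\in\mathcal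 K}\rho_k$, and assume $\rho<1$. Binomial-exhaustive policy (BEP). It has a parameter $\mathbf r=(r_1,\dots,r_I)\in\mathcal R:=\{\mathbf r\in[0,1]^I:\ \sum_{i\in\mathcal I:\,p(i)=k}r_i>0\text{ for all }k\in\mathcal K\}$. If the server finds $N$ customers in queue $p(i)$ at the start of a visit at stage $i$, then it serves queue $p(i)$ until its queue length is reduced to $N-Y_i(N,r_i)$, where $Y_i(N,r_i)$ is a binomial random variable with parameters $N$ and $r_i$, independent of everything else. (Equivalently, each of the $N$ customers is independently selected with probability $r_i$, and each selected customer generates an independent $M/G/1$ busy period with arrival rate $\lambda_{p(i)}$ and service times distributed as $S_{p(i)}$.) Steady state. The polling epoch of a stage is the starting time of the visit; a cycle is the time between consecutive polling epochs of stage $1$. $Q_k(t)$ is the number of customers in queue $k$ at time $t$ and $Q(t)=(Q_k(t))_{k\in\mathcal K}$. Since $\rho<1$, the chain of queue-length vectors embedded at the successive polling epochs of stage $1$ is an ergodic discrete-time Markov chain whose stationary distribution has finite mean, and the system is considered in the corresponding steady state; $A_i$ denotes a generic polling epoch of stage $i$ in steady state, so $Q(A_i)$ has the stationary distribution of the queue-length vector at the polling epochs of stage $i$. *)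

theory Defs
  imports "HOL-Probability.Probability"
begin

definition poisson_process :: "'a measure \<Rightarrow> real \<Rightarrow> (real \<Rightarrow> 'a \<Rightarrow> nat) \<Rightarrow> bool" where
  "poisson_process M rate N \<longleftrightarrow>
     (\<forall>t\<ge>0. N t \<in> measurable M (count_space UNIV)) \<and>
     (\<forall>\<omega>\<in>space M. N 0 \<omega> = 0 \<and> mono_on {0..} (\<lambda>t. N t \<omega>) \<and>
        (\<forall>t\<ge>0. continuous (at_right t) (\<lambda>u. real (N u \<omega>)))) \<and>
     (\<forall>n t. 0 \<le> t 0 \<and> (\<forall>j<n. t j \<le> t (Suc j)) \<longrightarrow>
        prob_space.indep_vars M (\<lambda>_. count_space UNIV)
          (\<lambda>j \<omega>. N (t (Suc j)) \<omega> - N (t j) \<omega>) {..<n}) \<and>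
     (\<forall>u t. 0 \<le> u \<and> u < t \<longrightarrow>
        distr M (count_space UNIV) (\<lambda>\<omega>. N t \<omega> - N u \<omega>) =
          measure_pmf (poisson_pmf (rate * (t - u))))"

text \<open>
  Queues are numbered \<open>1..K\<close> and stages \<open>1..I\<close>. Visits of the server are numbered
  \<open>0, 1, 2, \<dots>\<close>, so visit \<open>c * I + (i - 1)\<close> is the visit at stage \<open>i\<close> in cycle \<open>c\<close>.
\<close>

definition next_stage :: "nat \<Rightarrow> nat \<Rightarrow> nat" where
  "next_stage I i = (if i = I then 1 else i + 1)"

definition stage :: "nat \<Rightarrow> nat \<Rightarrow> nat" where
  "stage I m = m mod I + 1"

text \<open>
  Number of services in a visit that starts at time \<open>a\<close> with \<open>x\<close> waiting customers and ends
  when the queue length is reduced to \<open>x - y\<close>. Here \<open>N\<close> is a path of the arrival process of the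
  visited queue and \<open>S j\<close> the duration of the service number \<open>j\<close> (from 0) of this visit.
  The level \<open>x - y\<close> can only be reached at the start of the visit or at a service completion,
  because the queue length decreases in unit steps there and only increases elsewhere.
\<close>

definition num_services :: "(real \<Rightarrow> nat) \<Rightarrow> (nat \<Rightarrow> real) \<Rightarrow> real \<Rightarrow> nat \<Rightarrow> nat \<Rightarrow> nat" where
  "num_services N S a x y =
     (LEAST n. int x + int (N (a + (\<Sum>j<n. S j)) - N a) - int n = int x - int y)"

text \<open>
  Sample path at the polling epochs. \<open>polling_state I p N S V Y Q0 m \<omega>\<close> is the time of the
  polling epoch of visit \<open>m\<close> together with the queue-length vector at that time. Visit \<open>0\<close>
  (stage \<open>1\<close>) starts at time \<open>0\<close> with queue-length vector \<open>Q0\<close>. \<open>N k t\<close> counts the arrivals at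
  queue \<open>k\<close> in \<open>(0, t]\<close>; \<open>S m j\<close> is the duration of service \<open>j\<close> in visit \<open>m\<close>; \<open>V m\<close> is the switchover
  time after visit \<open>m\<close>; \<open>Y m n\<close> is the binomial variable that is used in visit \<open>m\<close> when the
  server finds \<open>n\<close> customers. The subtraction of the number of departures is not truncated
  except on a null set (the visit never ends, or \<open>Y m n\<close> exceeds \<open>n\<close>).
\<close>

primrec polling_state ::
  "nat \<Rightarrow> (nat \<Rightarrow> nat) \<Rightarrow> (nat \<Rightarrow> real \<Rightarrow> 'a \<Rightarrow> nat) \<Rightarrow> (nat \<Rightarrow> nat \<Rightarrow> 'a \<Rightarrow> real) \<Rightarrow>
   (nat \<Rightarrow> 'a \<Rightarrow> real) \<Rightarrow> (nat \<Rightarrow> nat \<Rightarrow> 'a \<Rightarrow> nat) \<Rightarrow> (nat \<Rightarrow> 'a \<Rightarrow> nat) \<Rightarrow>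
   nat \<Rightarrow> 'a \<Rightarrow> real \<times> (nat \<Rightarrow> nat)" where
  "polling_state I p N S V Y Q0 0 \<omega> = (0, \<lambda>k. Q0 k \<omega>)"
| "polling_state I p N S V Y Q0 (Suc m) \<omega> =
     (let (a, x) = polling_state I p N S V Y Q0 m \<omega>;
          h = p (stage I m);
          n = num_services (\<lambda>t. N h t \<omega>) (\<lambda>j. S m j \<omega>) a (x h) (Y m (x h) \<omega>);
          a' = a + (\<Sum>j<n. S m j \<omega>) + V m \<omega>
      in (a', \<lambda>k. x k + (N k a' \<omega> - N k a \<omega>) - (if k = h then n else 0)))"

definition queue_at_epoch ::
  "nat \<Rightarrow> (nat \<Rightarrow> nat) \<Rightarrow> (nat \<Rightarrow> real \<Rightarrow> 'a \<Rightarrow> nat) \<Rightarrow> (nat \<Rightarrow> nat \<Rightarrow> 'a \<Rightarrow> real) \<Rightarrow>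
   (nat \<Rightarrow> 'a \<Rightarrow> real) \<Rightarrow> (nat \<Rightarrow> nat \<Rightarrow> 'a \<Rightarrow> nat) \<Rightarrow> (nat \<Rightarrow> 'a \<Rightarrow> nat) \<Rightarrow>
   nat \<Rightarrow> nat \<Rightarrow> nat \<Rightarrow> 'a \<Rightarrow> nat" where
  "queue_at_epoch I p N S V Y Q0 c i k \<omega> =
     snd (polling_state I p N S V Y Q0 (c * I + (i - 1)) \<omega>) k"

text \<open>Events determined by a family of random variables with common target space.\<close>

definition gen_events :: "'a measure \<Rightarrow> 'b measure \<Rightarrow> 't set \<Rightarrow> ('t \<Rightarrow> 'a \<Rightarrow> 'b) \<Rightarrow> 'a set set" where
  "gen_events M B T X =
     sigma_sets (space M) (\<Union>t\<in>T. {X t -` A \<inter> space M | A. A \<in> sets B})"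

text \<open>
  The sources of randomness. The variables \<open>Y m n\<close> of one visit \<open>m\<close> form a single source, since
  at most one of them is used; nothing is assumed on their joint law.
\<close>

datatype source = Arrivals nat | Service nat nat | Switchover nat | Selection nat | Initial

fun source_events ::
  "'a measure \<Rightarrow> nat \<Rightarrow> (nat \<Rightarrow> real \<Rightarrow> 'a \<Rightarrow> nat) \<Rightarrow> (nat \<Rightarrow> nat \<Rightarrow> 'a \<Rightarrow> real) \<Rightarrow>
   (nat \<Rightarrow> 'a \<Rightarrow> real) \<Rightarrow> (nat \<Rightarrow> nat \<Rightarrow> 'a \<Rightarrow> nat) \<Rightarrow> (nat \<Rightarrow> 'a \<Rightarrow> nat) \<Rightarrow>
   source \<Rightarrow> 'a set set" where
  "source_events M K N S V Y Q0 (Arrivals k) = gen_events M (count_space UNIV) {0..} (N k)"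
| "source_events M K N S V Y Q0 (Service m j) = gen_events M borel {j} (S m)"
| "source_events M K N S V Y Q0 (Switchover m) = gen_events M borel {m} V"
| "source_events M K N S V Y Q0 (Selection m) = gen_events M (count_space UNIV) UNIV (Y m)"
| "source_events M K N S V Y Q0 Initial = gen_events M (count_space UNIV) {1..K} Q0"

definition sources :: "nat \<Rightarrow> source set" where
  "sources K = {z. \<forall>k. z = Arrivals k \<longrightarrow> k \<in> {1..K}}"

text \<open>
  \<open>B k\<close> and \<open>W i\<close> are the laws of the generic service time at queue \<open>k\<close> and of the generic
  switchover time after stage \<open>i\<close>.
\<close>

locale bep_polling_system = prob_space M
  for M :: "'a measure" +
  fixes K I :: nat
    and p :: "nat \<Rightarrow> nat"
    and lam mu :: "nat \<Rightarrow> real"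
    and B :: "nat \<Rightarrow> real measure"
    and s :: "nat \<Rightarrow> real"
    and W :: "nat \<Rightarrow> real measure"
    and r :: "nat \<Rightarrow> real"
    and N :: "nat \<Rightarrow> real \<Rightarrow> 'a \<Rightarrow> nat"
    and S :: "nat \<Rightarrow> nat \<Rightarrow> 'a \<Rightarrow> real"
    and V :: "nat \<Rightarrow> 'a \<Rightarrow> real"
    and Y :: "nat \<Rightarrow> nat \<Rightarrow> 'a \<Rightarrow> nat"
    and Q0 :: "nat \<Rightarrow> 'a \<Rightarrow> nat"
  assumes K_pos: "1 \<le> K"
    and K_le_I: "K \<le> I"
    and table: "\<And>i. i \<in> {1..I} \<Longrightarrow> p i \<in> {1..K}"
    and lam_pos: "\<And>k. k \<in> {1..K} \<Longrightarrow> 0 < lam k"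
    and mu_pos: "\<And>k. k \<in> {1..K} \<Longrightarrow> 0 < mu k"
    and service_law_mean: "\<And>k. k \<in> {1..K} \<Longrightarrow> integrable (B k) (\<lambda>x. x) \<and> (\<integral>x. x \<partial>B k) = 1 / mu k"
    and switchover_law_mean: "\<And>i. i \<in> {1..I} \<Longrightarrow> integrable (W i) (\<lambda>x. x) \<and> (\<integral>x. x \<partial>W i) = s i"
    and switchover_total: "0 < (\<Sum>i=1..I. s i)"
    and stable: "(\<Sum>k=1..K. lam k / mu k) < 1"
    and r_bounds: "\<And>i. i \<in> {1..I} \<Longrightarrow> 0 \<le> r i \<and> r i \<le> 1"
    and r_queue: "\<And>k. k \<in> {1..K} \<Longrightarrow> 0 < (\<Sum>i | i \<in> {1..I} \<and> p i = k. r i)"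
    and arrivals: "\<And>k. k \<in> {1..K} \<Longrightarrow> poisson_process M (lam k) (N k)"
    and services: "\<And>m j. random_variable borel (S m j) \<and> distr M borel (S m j) = B (p (stage I m))"
    and services_nonneg: "\<And>m j \<omega>. \<omega> \<in> space M \<Longrightarrow> 0 \<le> S m j \<omega>"
    and switchovers: "\<And>m. random_variable borel (V m) \<and> distr M borel (V m) = W (stage I m)"
    and switchovers_nonneg: "\<And>m \<omega>. \<omega> \<in> space M \<Longrightarrow> 0 \<le> V m \<omega>"
    and selections: "\<And>m n. random_variable (count_space UNIV) (Y m n) \<and>
           distr M (count_space UNIV) (Y m n) = measure_pmf (binomial_pmf n (r (stage I m)))"
    and initial: "\<And>k. k \<in> {1..K} \<Longrightarrow> random_variable (count_space UNIV) (Q0 k)"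
    and independence: "indep_sets (source_events M K N S V Y Q0) (sources K)"

text \<open>
  Steady state: the chain of queue-length vectors at the polling epochs of stage \<open>1\<close> is
  started in a stationary distribution with finite mean.
\<close>

definition steady_state ::
  "'a measure \<Rightarrow> nat \<Rightarrow> nat \<Rightarrow> (nat \<Rightarrow> nat) \<Rightarrow> (nat \<Rightarrow> real \<Rightarrow> 'a \<Rightarrow> nat) \<Rightarrow>
   (nat \<Rightarrow> nat \<Rightarrow> 'a \<Rightarrow> real) \<Rightarrow> (nat \<Rightarrow> 'a \<Rightarrow> real) \<Rightarrow> (nat \<Rightarrow> nat \<Rightarrow> 'a \<Rightarrow> nat) \<Rightarrow>
   (nat \<Rightarrow> 'a \<Rightarrow> nat) \<Rightarrow> bool" where
  "steady_state M K I p N S V Y Q0 \<longleftrightarrow>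
     (\<forall>c. distr M (PiM {1..K} (\<lambda>_. count_space UNIV))
            (\<lambda>\<omega>. \<lambda>k\<in>{1..K}. queue_at_epoch I p N S V Y Q0 c 1 k \<omega>) =
          distr M (PiM {1..K} (\<lambda>_. count_space UNIV)) (\<lambda>\<omega>. \<lambda>k\<in>{1..K}. Q0 k \<omega>)) \<and>
     (\<forall>k\<in>{1..K}. integrable M (\<lambda>\<omega>. real (Q0 k \<omega>)))"

definition mean_queue_equations ::
  "nat \<Rightarrow> nat \<Rightarrow> (nat \<Rightarrow> nat) \<Rightarrow> (nat \<Rightarrow> real) \<Rightarrow> (nat \<Rightarrow> real) \<Rightarrow> (nat \<Rightarrow> real) \<Rightarrow>
   (nat \<Rightarrow> real) \<Rightarrow> (nat \<Rightarrow> nat \<Rightarrow> real) \<Rightarrow> bool" where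
  "mean_queue_equations K I p lam mu s r q \<longleftrightarrow>
     (\<forall>k\<in>{1..K}. \<forall>i\<in>{1..I}.
        (k = p i \<longrightarrow>
           q k (next_stage I i) = s i * lam k + (1 - r i) * q k i) \<and>
        (k \<noteq> p i \<longrightarrow>
           q k (next_stage I i) = s i * lam k + q k i +
             q (p i) i * r i * lam k * (1 / (mu (p i) * (1 - lam (p i) / mu (p i))))))"

end

theory Submission
  imports Defs
begin

text \<open>
  A visit at stage \<open>i\<close> that finds \<open>x\<close> customers ends after \<open>n\<close> services, where \<open>n\<close> is the number
  \<open>Y\<close> of selected customers plus the number of arrivals at the visited queue during the visit.
  The epochs are stopping times for the arrival processes, so by Wald's identity the mean number of
  arrivals at queue \<open>k\<close> in an interval between epochs is \<open>\<lambda>\<^sub>k\<close> times its mean length, and the mean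
  length of the visit is \<open>E n / \<mu>\<close>. Hence \<open>E n = r E x + \<rho> E n\<close> for the visited queue, which gives
  the equations. Finiteness of \<open>E n\<close>, and thus almost sure termination of the visit, follows from the
  same identity, as an inequality, for the visit truncated after \<open>J\<close> services.

  For uniqueness, let \<open>d\<close> be the difference of two solutions. The weighted norm \<open>\<Sum>k. \<bar>d k i\<bar> / \<mu>\<^sub>k\<close>
  decreases at stage \<open>i\<close> by at least \<open>(1 - \<rho>) \<theta>\<^sub>i\<close>, where \<open>\<theta>\<^sub>i \<ge> 0\<close> is proportional to
  \<open>r\<^sub>i \<bar>d (p i) i\<bar>\<close>. Around a cycle it does not change, so all \<open>\<theta>\<^sub>i\<close> vanish, \<open>d\<close> does not depend on
  the stage, and it is zero because each queue has a stage with \<open>r\<^sub>i > 0\<close>.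
\<close>

section \<open>Poisson processes and Wald's identity\<close>

text \<open>\<open>X\<close> and \<open>indicator A\<close>, indexed by \<open>bool\<close>, form an
  independent family, so the product formula for nonnegative variables applies. Values in
  \<open>ennreal\<close> allow its use before any finiteness is known. Every Wald argument below
  factors its summands by this rule.\<close>

lemma (in prob_space) nn_integral_indep_indicator:
  fixes X :: "'a \<Rightarrow> ennreal"
  assumes ind: "indep_set (sets F) (sets G)"
    and space: "space F = space M" "space G = space M"
    and X: "X \<in> borel_measurable F" and A: "A \<in> sets G"
  shows "(\<integral>\<^sup>+\<omega>. X \<omega> * indicator A \<omega> \<partial>M) = (\<integral>\<^sup>+\<omega>. X \<omega> \<partial>M) * emeasure M A"
proof -
  let ?Z = "case_bool X (indicator A :: 'a \<Rightarrow> ennreal)"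
  have FG: "sets F \<subseteq> events" "sets G \<subseteq> events"
    using indep_setD_ev1[OF ind] indep_setD_ev2[OF ind] by auto
  have sF: "subalgebra M F" and sG: "subalgebra M G"
    using FG space by (auto simp: subalgebra_def)
  have XM: "X \<in> borel_measurable M"
    using measurable_from_subalg[OF sF X] .
  have AG: "(indicator A :: 'a \<Rightarrow> ennreal) \<in> borel_measurable G"
    using A by measurable
  have "indep_vars (\<lambda>_. borel) ?Z UNIV"
    unfolding indep_vars_def2
  proof (intro conjI ballI)
    show "random_variable borel (?Z b)" for b
      using XM A FG by (cases b) auto
    show "indep_sets (\<lambda>i. {?Z i -` B \<inter> space M |B. B \<in> sets borel}) UNIV"
      using ind[unfolded indep_set_def]
    proof (rule indep_sets_mono_sets)
      fix b :: bool
      show "{?Z b -` B \<inter> space M |B. B \<in> sets borel} \<subseteq> (case b of True \<Rightarrow> sets F | False \<Rightarrow> sets G)"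
        using measurable_sets[OF X] measurable_sets[OF AG] space by (cases b) auto
    qed
  qed
  then have "(\<integral>\<^sup>+\<omega>. (\<Prod>b\<in>UNIV. ?Z b \<omega>) \<partial>M) = (\<Prod>b\<in>UNIV. \<integral>\<^sup>+\<omega>. ?Z b \<omega> \<partial>M)"
    by (intro indep_vars_nn_integral) auto
  moreover have "(\<integral>\<^sup>+\<omega>. indicator A \<omega> \<partial>M) = emeasure M A"
    using A FG by (intro nn_integral_indicator) auto
  ultimately show ?thesis
    by (simp add: UNIV_bool mult.commute)
qed

section \<open>Sigma-algebras generated by families of random variables\<close>

lemma gen_events_space: "gen_events M B T X \<subseteq> Pow (space M)"
  unfolding gen_events_def by (rule subsetI, drule sigma_sets_into_sp[rotated]) auto

lemma sigma_gen_events: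
  "sets (sigma (space M) (gen_events M B T X)) = gen_events M B T X"
  "space (sigma (space M) (gen_events M B T X)) = space M"
proof -
  interpret sigma_algebra "space M" "gen_events M B T X"
    unfolding gen_events_def by (rule sigma_algebra_sigma_sets) auto
  show "sets (sigma (space M) (gen_events M B T X)) = gen_events M B T X"
    by (rule sets_measure_of_eq)
qed (rule space_measure_of_conv)

lemma gen_events_mono: "T \<subseteq> T' \<Longrightarrow> gen_events M B T X \<subseteq> gen_events M B T' X"
  unfolding gen_events_def by (intro sigma_sets_mono') auto

lemma vimage_in_gen_events:
  "t \<in> T \<Longrightarrow> A \<in> sets B \<Longrightarrow> X t -` A \<inter> space M \<in> gen_events M B T X"
  unfolding gen_events_def by (intro sigma_sets.Basic) auto

lemma Int_stable_sigma_sets: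
  assumes "G \<subseteq> Pow Z"
  shows "Int_stable (sigma_sets Z G)"
proof -
  interpret sigma_algebra Z "sigma_sets Z G"
    using assms by (rule sigma_algebra_sigma_sets)
  show ?thesis by (auto simp: Int_stable_def)
qed

lemma Int_stable_vimages: "Int_stable {f -` A \<inter> Z |A. A \<in> sets L}"
proof (rule Int_stableI)
  fix a b assume "a \<in> {f -` A \<inter> Z |A. A \<in> sets L}" "b \<in> {f -` A \<inter> Z |A. A \<in> sets L}"
  then obtain A B where AB: "A \<in> sets L" "B \<in> sets L" "a = f -` A \<inter> Z" "b = f -` B \<inter> Z"
    by auto
  show "a \<inter> b \<in> {f -` A \<inter> Z |A. A \<in> sets L}"
  proof (rule CollectI, rule exI[of _ "A \<inter> B"], rule conjI)
    show "a \<inter> b = f -` (A \<inter> B) \<inter> Z" unfolding AB by blast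
    show "A \<inter> B \<in> sets L" using AB by simp
  qed
qed

lemma Int_stable_gen_events: "Int_stable (gen_events M B T X)"
  unfolding gen_events_def by (rule Int_stable_sigma_sets) auto

section \<open>Independence of Poisson increments from the past\<close>

lemma (in prob_space) poisson_increments_determine_past:
  assumes pp: "poisson_process M rate X"
    and tt: "tt 0 = 0" "\<And>j. j < n \<Longrightarrow> tt j \<le> tt (Suc j)" and j: "j \<le> n"
    and \<omega>: "\<omega> \<in> space M"
  shows "X (tt j) \<omega> = (\<Sum>i<j. X (tt (Suc i)) \<omega> - X (tt i) \<omega>)"
proof -
  have X: "X 0 \<omega> = 0" "mono_on {0..} (\<lambda>t. X t \<omega>)"
    using pp \<omega> by (auto simp: poisson_process_def)
  from j show ?thesis
  proof (induction j)
    case 0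
    then show ?case using X tt by simp
  next
    case (Suc j)
    have nn: "0 \<le> tt i" if "i \<le> n" for i
      using that
    proof (induction i)
      case (Suc i)
      then show ?case using tt(2)[of i] by auto
    qed (use tt in simp)
    \<comment> \<open>Monotone paths keep the truncated subtraction of naturals exact, so the sum
      telescopes.\<close>
    have "X (tt j) \<omega> \<le> X (tt (Suc j)) \<omega>"
      using mono_onD[OF X(2), of "tt j" "tt (Suc j)"] nn[of j] nn[of "Suc j"] tt(2)[of j] Suc.prems by auto
    then show ?case
      using Suc by simp
  qed
qed

text \<open>The process is only known to have independent increments along increasing sequences of
  times. Along the sequence made of 0, the points of \<open>F\<close>, then \<open>t\<close> and
  \<open>u\<close>, each \<open>X v\<close> with \<open>v\<close> in \<open>F\<close> is a sum of
  increments before the last one, and the last one is \<open>X u - X t\<close>.\<close>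

lemma (in prob_space) poisson_finite_past_indep:
  assumes pp: "poisson_process M rate X" and tu: "0 \<le> t" "t < u"
    and F: "finite F" "F \<subseteq> {0..t}"
  shows "prob ({\<omega>\<in>space M. \<forall>v\<in>F. X v \<omega> \<in> A v} \<inter> {\<omega>\<in>space M. X u \<omega> - X t \<omega> \<in> C}) =
    prob {\<omega>\<in>space M. \<forall>v\<in>F. X v \<omega> \<in> A v} * prob {\<omega>\<in>space M. X u \<omega> - X t \<omega> \<in> C}"
proof -
  \<comment> \<open>Repeated times, as when 0 or \<open>t\<close> lies in \<open>F\<close>, are
    harmless: the sequence only has to be nondecreasing.\<close>
  define L where "L = 0 # sorted_list_of_set F @ [t, u]"
  define n where "n = Suc (card F)"
  \<comment> \<open>The minimum extends the list by its last entry, so \<open>tt\<close> is a total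
    nondecreasing sequence.\<close>
  define tt where "tt j = L ! (min j (Suc n))" for j
  have len: "length L = Suc (Suc n)"
    using F by (simp add: L_def n_def)
  have sorted: "sorted L"
    unfolding L_def using F tu by (auto simp: sorted_append)
  have mono: "tt j \<le> tt (Suc j)" for j
    unfolding tt_def using sorted len by (intro sorted_nth_mono) auto
  have tt0: "tt 0 = 0" by (simp add: tt_def L_def)
  have ttn: "tt n = t" and ttSn: "tt (Suc n) = u"
    using F by (auto simp: tt_def L_def n_def nth_append)
  have F_tt: "\<exists>j\<le>n. v = tt j" if "v \<in> F" for v
  proof -
    have "v \<in> set (0 # sorted_list_of_set F)" using that F by simp
    then obtain j where j: "j < length (0 # sorted_list_of_set F)" "(0 # sorted_list_of_set F) ! j = v"
      by (metis in_set_conv_nth)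
    have "j \<le> n" using j F by (simp add: n_def)
    moreover have "tt j = v"
    proof -
      have "L ! j = (0 # sorted_list_of_set F) ! j"
        unfolding L_def append_Cons[symmetric] using j by (simp only: nth_append if_True)
      then show ?thesis using j \<open>j \<le> n\<close> by (simp add: tt_def)
    qed
    ultimately show ?thesis by auto
  qed
  let ?D = "\<lambda>j \<omega>. X (tt (Suc j)) \<omega> - X (tt j) \<omega>"
  let ?E = "\<lambda>j. {?D j -` S \<inter> space M |S. S \<in> sets (count_space (UNIV :: nat set))}"
  have iv: "indep_vars (\<lambda>_. count_space UNIV) ?D {..<Suc n}"
  proof -
    have "\<forall>n t. 0 \<le> t 0 \<and> (\<forall>j<n. t j \<le> t (Suc j)) \<longrightarrow>
        indep_vars (\<lambda>_. count_space UNIV) (\<lambda>j \<omega>. X (t (Suc j)) \<omega> - X (t j) \<omega>) {..<n}"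
      using pp unfolding poisson_process_def by blast
    from this[rule_format, of tt "Suc n"] show ?thesis
      using tt0 mono by simp
  qed
  \<comment> \<open>The increments are grouped into the first \<open>n\<close>, which carry the
    past, and the one with index \<open>n\<close>, which is \<open>X u - X t\<close>.\<close>
  have "indep_sets ?E (\<Union>b\<in>UNIV. case_bool {..<n} {n} b)"
  proof -
    have "(\<Union>b\<in>UNIV. case_bool {..<n} {n} b) = {..<Suc n}"
      by (auto simp: UNIV_bool)
    then show ?thesis
      using iv by (simp add: indep_vars_def2)
  qed
  then have "indep_sets (\<lambda>b. sigma_sets (space M) (\<Union>i\<in>case_bool {..<n} {n} b. ?E i)) UNIV"
  proof (rule indep_sets_collect_sigma)
    show "Int_stable (?E i)" for i
      by (rule Int_stable_vimages)
    show "disjoint_family_on (case_bool {..<n} {n}) UNIV"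
      by (auto simp: disjoint_family_on_def UNIV_bool)
  qed
  then have ind: "indep_set (sigma_sets (space M) (\<Union>i<n. ?E i)) (sigma_sets (space M) (?E n))"
    unfolding indep_set_def by (rule indep_sets_mono_sets) (auto split: bool.splits)
  define G where "G = sigma (space M) (\<Union>i<n. ?E i)"
  have sG: "sets G = sigma_sets (space M) (\<Union>i<n. ?E i)" "space G = space M"
    unfolding G_def by (auto intro!: sets_measure_of space_measure_of)
  have D: "?D i \<in> measurable G (count_space UNIV)" if "i < n" for i
    using that by (intro measurableI) (auto simp: sG intro!: sigma_sets.Basic)
  have Xtt: "X (tt j) \<in> measurable G (count_space UNIV)" if "j \<le> n" for j
  proof -
    have "(\<lambda>\<omega>. \<Sum>i<j. ?D i \<omega>) \<in> measurable G (count_space UNIV)"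
      using D that by (intro measurable_sum_nat) auto
    moreover have "(\<lambda>\<omega>. \<Sum>i<j. ?D i \<omega>) \<omega> = X (tt j) \<omega>" if "\<omega> \<in> space G" for \<omega>
      using poisson_increments_determine_past[OF pp tt0 mono \<open>j \<le> n\<close>, of \<omega>] that sG by simp
    ultimately show ?thesis
      by (subst measurable_cong[symmetric]) auto
  qed
  have X: "X v \<in> measurable G (count_space UNIV)" if "v \<in> F" for v
    using F_tt[OF that] Xtt by auto
  have "{\<omega>\<in>space G. X v \<omega> \<in> A v} \<in> sets G" if "v \<in> F" for v
    using measurable_sets[OF X[OF that], of "A v"] by (simp add: vimage_def Int_def conj_commute)
  then have "{\<omega>\<in>space G. \<forall>v\<in>F. X v \<omega> \<in> A v} \<in> sets G"
    using F(1) by (rule sets.sets_Collect_finite_All)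
  then have 1: "{\<omega>\<in>space M. \<forall>v\<in>F. X v \<omega> \<in> A v} \<in> sigma_sets (space M) (\<Union>i<n. ?E i)"
    by (simp add: sG)
  have 2: "{\<omega>\<in>space M. X u \<omega> - X t \<omega> \<in> C} \<in> sigma_sets (space M) (?E n)"
    by (rule sigma_sets.Basic) (auto simp: ttn ttSn)
  show ?thesis
    by (rule indep_setD[OF ind 1 2])
qed

text \<open>\<open>P\<close> consists of the finite-dimensional cylinder events. As an
  intersection-stable generator of the history on \<open>T\<close>, it reduces independence to
  finitely many times.\<close>

lemma finite_past_events:
  fixes M :: "'a measure" and T :: "real set" and X :: "real \<Rightarrow> 'a \<Rightarrow> nat"
  defines "P \<equiv> {{\<omega>\<in>space M. \<forall>v\<in>F. X v \<omega> \<in> A v} |F A. finite F \<and> F \<subseteq> T}"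
  shows "Int_stable P"
    and "gen_events M (count_space UNIV) T X \<subseteq> sigma_sets (space M) P"
    and "P \<subseteq> Pow (space M)"
    and "P \<subseteq> gen_events M (count_space UNIV) T X"
proof -
  show "Int_stable P"
  proof (rule Int_stableI)
    fix a b assume "a \<in> P" "b \<in> P"
    then obtain F A H B where *: "finite F" "F \<subseteq> T" "finite H" "H \<subseteq> T"
      "a = {\<omega>\<in>space M. \<forall>v\<in>F. X v \<omega> \<in> A v}" "b = {\<omega>\<in>space M. \<forall>v\<in>H. X v \<omega> \<in> B v}"
      unfolding P_def by auto
    let ?C = "\<lambda>v. (if v \<in> F then A v else UNIV) \<inter> (if v \<in> H then B v else UNIV)"
    have "a \<inter> b = {\<omega>\<in>space M. \<forall>v\<in>F \<union> H. X v \<omega> \<in> ?C v}"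
      using * by auto
    then show "a \<inter> b \<in> P"
      unfolding P_def using * by (intro CollectI exI[of _ "F \<union> H"] exI[of _ ?C]) auto
  qed
  show sub: "P \<subseteq> Pow (space M)" by (auto simp: P_def)
  show "gen_events M (count_space UNIV) T X \<subseteq> sigma_sets (space M) P"
    unfolding gen_events_def
  proof (rule sigma_sets_mono, safe)
    fix t A assume "t \<in> T"
    have "X t -` A \<inter> space M = {\<omega>\<in>space M. \<forall>v\<in>{t}. X v \<omega> \<in> A}" by auto
    also have "\<dots> \<in> P"
      unfolding P_def using \<open>t \<in> T\<close> by (intro CollectI exI[of _ "{t}"] exI[of _ "\<lambda>_. A"]) auto
    finally show "X t -` A \<inter> space M \<in> sigma_sets (space M) P" by auto
  qed
  show "P \<subseteq> gen_events M (count_space UNIV) T X"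
  proof
    fix a assume "a \<in> P"
    then obtain F A where a: "finite F" "F \<subseteq> T" "a = {\<omega>\<in>space M. \<forall>v\<in>F. X v \<omega> \<in> A v}"
      by (auto simp: P_def)
    interpret sigma_algebra "space M" "gen_events M (count_space UNIV) T X"
      unfolding gen_events_def by (rule sigma_algebra_sigma_sets) auto
    have "{\<omega>\<in>space M. X v \<omega> \<in> A v} \<in> gen_events M (count_space UNIV) T X" if "v \<in> F" for v
      using vimage_in_gen_events[of v T "A v" "count_space UNIV" X M] that a(2)
      by (auto simp: vimage_def Int_def conj_commute)
    then show "a \<in> gen_events M (count_space UNIV) T X"
      using a by (auto intro!: sets_Collect_finite_All)
  qed
qed

text \<open>The events known at time \<open>t\<close> if all sources except \<open>X\<close>, collected in \<open>G\<close>, are revealed at time 0.\<close>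

definition past :: "'a measure \<Rightarrow> (real \<Rightarrow> 'a \<Rightarrow> nat) \<Rightarrow> 'a measure \<Rightarrow> real \<Rightarrow> 'a measure" where
  "past M X G t = sigma (space M) (gen_events M (count_space UNIV) {0..t} X \<union> sets G)"

text \<open>Intersections of a cylinder event before \<open>t\<close> with an event of
  \<open>G\<close> form an intersection-stable generator of \<open>past M X G t\<close>. On them,
  independence combines that of \<open>G\<close> from the whole process with that of the increment
  from finitely many past values.\<close>

lemma (in prob_space) poisson_increment_indep:
  assumes pp: "poisson_process M rate X" and tu: "0 \<le> t" "t < u"
    and ind: "indep_set (gen_events M (count_space UNIV) {0..} X) (sets G)"
    and space: "space G = space M"
  shows "indep_set (sets (vimage_algebra (space M) (\<lambda>\<omega>. X u \<omega> - X t \<omega>) (count_space UNIV)))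
    (sets (past M X G t))"
proof -
  let ?gen = "\<lambda>T. gen_events M (count_space UNIV) T X"
  define P where "P = {{\<omega>\<in>space M. \<forall>v\<in>F. X v \<omega> \<in> A v} |F A. finite F \<and> F \<subseteq> {0..t}}"
  note P = finite_past_events[where X=X and T="{0..t}" and M=M, folded P_def]
  let ?inc = "\<lambda>\<omega>. X u \<omega> - X t \<omega>"
  define D where "D = {?inc -` C \<inter> space M |C. C \<in> sets (count_space UNIV)}"
  define R where "R = {a \<inter> b |a b. a \<in> P \<and> b \<in> sets G}"
  have gen_events: "?gen {0..} \<subseteq> events"
    using indep_setD_ev1[OF ind] .
  have Gev: "sets G \<subseteq> events"
    using indep_setD_ev2[OF ind] .
  have Pgen: "P \<subseteq> ?gen {0..}"
    by (rule order_trans[OF P(4) gen_events_mono]) auto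
  have Dgen: "D \<subseteq> ?gen {0..}"
  proof -
    let ?S = "sigma (space M) (?gen {0..})"
    have S: "sets ?S = ?gen {0..}" "space ?S = space M"
      by (rule sigma_gen_events)+
    have X: "X v \<in> measurable ?S (count_space UNIV)" if "0 \<le> v" for v
      using that by (intro measurableI) (auto simp: S intro!: vimage_in_gen_events)
    have [measurable]: "X u \<in> measurable ?S (count_space UNIV)" "X t \<in> measurable ?S (count_space UNIV)"
      using X tu by auto
    have "?inc \<in> measurable ?S (count_space UNIV)"
      by measurable
    from measurable_sets[OF this] show ?thesis
      unfolding D_def by (auto simp: S)
  qed
  have RS: "Int_stable R"
  proof (rule Int_stableI)
    fix x y assume "x \<in> R" "y \<in> R"
    then obtain a b c d where *: "x = a \<inter> b" "y = c \<inter> d" "a \<in> P" "b \<in> sets G" "c \<in> P" "d \<in> sets G"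
      unfolding R_def by auto
    have "x \<inter> y = (a \<inter> c) \<inter> (b \<inter> d)" using * by auto
    moreover have "a \<inter> c \<in> P" using P(1) * by (auto simp: Int_stable_def)
    ultimately show "x \<inter> y \<in> R" using * unfolding R_def by blast
  qed
  have "indep_set D R"
  proof (rule indep_setI)
    show "D \<subseteq> events" using Dgen gen_events by auto
    show "R \<subseteq> events" using Pgen gen_events Gev by (auto simp: R_def)
    fix d x assume d: "d \<in> D" and x: "x \<in> R"
    obtain a b where ab: "x = a \<inter> b" "a \<in> P" "b \<in> sets G" using x by (auto simp: R_def)
    obtain F A where F: "finite F" "F \<subseteq> {0..t}" "a = {\<omega>\<in>space M. \<forall>v\<in>F. X v \<omega> \<in> A v}"
      using ab by (auto simp: P_def)
    obtain C where C: "d = {\<omega>\<in>space M. ?inc \<omega> \<in> C}"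
      using d by (auto simp: D_def vimage_def Int_def conj_commute)
    \<comment> \<open>\<open>d\<close> and \<open>a\<close> both concern \<open>X\<close> alone, so
      \<open>b\<close> is split off first; the increment event \<open>d\<close> is then separated
      from the past event \<open>a\<close>.\<close>
    have "d \<inter> a \<in> ?gen {0..}"
      using Int_stable_gen_events[of M "count_space UNIV" "{0..}" X] d ab Dgen Pgen by (auto simp: Int_stable_def)
    then have "prob (d \<inter> x) = prob (d \<inter> a) * prob b"
      using indep_setD[OF ind, of "d \<inter> a" b] ab by (simp add: Int_assoc)
    moreover have "prob (d \<inter> a) = prob d * prob a"
      using poisson_finite_past_indep[OF pp tu F(1,2), of A C] F C by (simp add: Int_commute mult.commute)
    moreover have "prob x = prob a * prob b"
      using indep_setD[OF ind, of a b] ab Pgen by auto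
    ultimately show "prob (d \<inter> x) = prob d * prob x" by simp
  qed
  then have "indep_set (sigma_sets (space M) D) (sigma_sets (space M) R)"
    using RS Int_stable_vimages[of ?inc "space M" "count_space UNIV"]
    by (intro indep_set_sigma_sets) (auto simp: D_def)
  moreover have "sets (past M X G t) \<subseteq> sigma_sets (space M) R"
  proof -
    have P0: "space M \<in> P"
      unfolding P_def by (intro CollectI exI[of _ "{}"]) auto
    have "P \<subseteq> R"
    proof
      fix a assume "a \<in> P"
      moreover have "a = a \<inter> space M" using P(3) \<open>a \<in> P\<close> by auto
      ultimately show "a \<in> R" unfolding R_def using sets.top[of G] space by auto
    qed
    moreover have "sets G \<subseteq> R"
    proof
      fix b assume "b \<in> sets G"
      moreover have "b = space M \<inter> b" using sets.sets_into_space[OF \<open>b \<in> sets G\<close>] space by auto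
      ultimately show "b \<in> R" unfolding R_def using P0 by auto
    qed
    moreover have "?gen {0..t} \<subseteq> sigma_sets (space M) R"
      using P(2) sigma_sets_mono'[OF \<open>P \<subseteq> R\<close>] by blast
    ultimately have "?gen {0..t} \<union> sets G \<subseteq> sigma_sets (space M) R"
      by auto
    moreover have "?gen {0..t} \<union> sets G \<subseteq> Pow (space M)"
      using gen_events_space[of M "count_space UNIV" "{0..t}" X] sets.space_closed[of G] space by auto
    ultimately show ?thesis
      by (simp add: past_def sets_measure_of sigma_sets_mono)
  qed
  moreover have "sets (vimage_algebra (space M) ?inc (count_space UNIV)) \<subseteq> sigma_sets (space M) D"
    by (simp add: sets_vimage_algebra D_def)
  ultimately show ?thesis
    unfolding indep_set_def by (elim indep_sets_mono_sets) (auto split: bool.splits)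
qed

section \<open>Means of the binomial and Poisson distributions\<close>

lemma nn_integral_binomial_pmf:
  assumes "0 \<le> q" "q \<le> 1"
  shows "(\<integral>\<^sup>+ y. ennreal (real y) \<partial>binomial_pmf n q) = ennreal (q * real n)"
proof -
  have "measure_pmf.expectation (binomial_pmf n q) real = (\<Sum>k\<le>n. real k * Bernstein n k q)"
    using assms by (subst expectation_binomial_pmf') (auto simp: Bernstein_def mult.commute intro!: sum.cong)
  also have "\<dots> = q * real n"
    by (simp add: sum_k_Bernstein mult.commute)
  finally show ?thesis
    using assms by (subst nn_integral_eq_integral) auto
qed

lemma nn_integral_poisson_pmf:
  assumes "0 < a"
  shows "(\<integral>\<^sup>+ k. ennreal (real k) \<partial>poisson_pmf a) = ennreal a"
proof -
  let ?f = "\<lambda>k. real k * (a ^ k / fact k * exp (- a))"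
  have "(\<lambda>k. a * exp (- a) * (a ^ k /\<^sub>R fact k)) sums (a * exp (- a) * exp a)"
    by (intro sums_mult exp_converges)
  moreover have "a * exp (- a) * (a ^ k /\<^sub>R fact k) = ?f (Suc k)" for k
    by (simp add: field_simps del: of_nat_Suc)
  moreover have "a * exp (- a) * exp a = a"
    by (simp add: exp_minus)
  ultimately have "(\<lambda>k. ?f (Suc k)) sums a"
    by simp
  \<comment> \<open>The term with index 0 vanishes, so the shift of the exponential series costs
    nothing.\<close>
  then have "?f sums a"
    by (subst (asm) sums_Suc_iff) simp
  then have "(\<Sum>k. ennreal (?f k)) = ennreal a"
    using assms by (intro suminf_ennreal_eq) auto
  moreover have "(\<integral>\<^sup>+ k. ennreal (real k) \<partial>poisson_pmf a) = (\<Sum>k. ennreal (?f k))"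
    using assms
    by (simp add: nn_integral_measure_pmf nn_integral_count_space_nat ennreal_mult[symmetric] mult.commute)
  ultimately show ?thesis by simp
qed

lemma (in prob_space) poisson_increment_mean:
  assumes pp: "poisson_process M rate X" and "0 < rate" "0 \<le> t" "t < u"
  shows "(\<integral>\<^sup>+\<omega>. ennreal (real (X u \<omega> - X t \<omega>)) \<partial>M) = ennreal (rate * (u - t))"
proof -
  have [measurable]: "X u \<in> measurable M (count_space UNIV)" "X t \<in> measurable M (count_space UNIV)"
    using assms by (auto simp: poisson_process_def)
  have d: "distr M (count_space UNIV) (\<lambda>\<omega>. X u \<omega> - X t \<omega>) = measure_pmf (poisson_pmf (rate * (u - t)))"
    using assms by (auto simp: poisson_process_def)
  have "(\<integral>\<^sup>+\<omega>. ennreal (real (X u \<omega> - X t \<omega>)) \<partial>M) =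
      (\<integral>\<^sup>+ k. ennreal (real k) \<partial>distr M (count_space UNIV) (\<lambda>\<omega>. X u \<omega> - X t \<omega>))"
    by (subst nn_integral_distr) auto
  also have "\<dots> = ennreal (rate * (u - t))"
    unfolding d using assms by (intro nn_integral_poisson_pmf) auto
  finally show ?thesis .
qed

text \<open>Nonnegative times are rounded up to a multiple of \<open>1 / d\<close>. Rounding up
  makes the approximations approach \<open>x\<close> from the right, the side on which arrival paths
  are continuous, and lets each grid cell be judged by the past at its left end.\<close>

definition grid :: "nat \<Rightarrow> real \<Rightarrow> real" where
  "grid d x = real (nat \<lceil>x * real d\<rceil>) / real d"

lemma grid_ge: "0 < d \<Longrightarrow> x \<le> grid d x"
  unfolding grid_def using real_nat_ceiling_ge[of "x * real d"] by (simp add: field_simps)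

lemma grid_le: "0 < d \<Longrightarrow> 0 \<le> x \<Longrightarrow> grid d x \<le> x + 1 / real d"
proof -
  assume "0 < d" "0 \<le> x"
  moreover have "real (nat \<lceil>x * real d\<rceil>) \<le> x * real d + 1"
    using \<open>0 \<le> x\<close> of_int_ceiling_le_add_one[of "x * real d"] by (simp add: of_nat_nat)
  ultimately show ?thesis by (simp add: grid_def field_simps)
qed

text \<open>Integers are also multiples of \<open>1 / d\<close>. This makes mesh 1 the dominating
  case when the mesh tends to 0.\<close>

lemma grid_le_grid_1: "0 < d \<Longrightarrow> 0 \<le> x \<Longrightarrow> grid d x \<le> grid 1 x"
proof -
  assume d: "0 < d" and x: "0 \<le> x"
  have "x * real d \<le> real (nat \<lceil>x\<rceil> * d)"
    using real_nat_ceiling_ge[of x] d by simp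
  then have "nat \<lceil>x * real d\<rceil> \<le> nat \<lceil>x\<rceil> * d"
    by (simp only: nat_ceiling_le_eq)
  then have "real (nat \<lceil>x * real d\<rceil>) \<le> real (nat \<lceil>x\<rceil>) * real d"
    by (metis of_nat_le_iff of_nat_mult)
  then show ?thesis
    using d by (simp add: grid_def divide_le_eq)
qed

lemma grid_tendsto:
  assumes "0 \<le> x"
  shows "(\<lambda>n. grid (Suc n) x) \<longlonglongrightarrow> x"
proof (rule tendsto_sandwich[OF _ _ tendsto_const])
  show "\<forall>\<^sub>F n in sequentially. x \<le> grid (Suc n) x"
    by (intro always_eventually allI grid_ge) simp
  show "\<forall>\<^sub>F n in sequentially. grid (Suc n) x \<le> x + 1 / real (Suc n)"
    using assms by (intro always_eventually allI grid_le) auto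
  show "(\<lambda>n. x + 1 / real (Suc n)) \<longlonglongrightarrow> x"
    using tendsto_add[OF tendsto_const LIMSEQ_Suc[OF lim_1_over_n], of x] by simp
qed

text \<open>The filter \<open>at_right x\<close> leaves out \<open>x\<close>, which the sequence may
  attain; continuity within the closed half-line \<open>{x..}\<close> covers both cases.\<close>

lemma right_continuous_nat_tendsto:
  fixes f :: "real \<Rightarrow> nat"
  assumes f: "continuous (at_right x) (\<lambda>u. real (f u))"
    and a: "a \<longlonglongrightarrow> x" "\<And>n. x \<le> a n"
  shows "(\<lambda>n. real (f (a n))) \<longlonglongrightarrow> real (f x)"
proof -
  have "((\<lambda>u. real (f u)) \<longlongrightarrow> real (f x)) (at_right x)"
    using f by (simp add: continuous_within)
  then have "continuous (at x within {x..}) (\<lambda>u. real (f u))"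
    by (metis continuous_within at_within_Ici_at_right)
  then show ?thesis
    using a by (simp add: continuous_within_sequentially o_def)
qed

text \<open>At a rounded time only countably many values occur, so the evaluation is measurable;
  right-continuity carries this to the limit.\<close>

lemma measurable_right_continuous_eval:
  fixes X :: "real \<Rightarrow> 'a \<Rightarrow> nat"
  assumes X: "\<And>t. 0 \<le> t \<Longrightarrow> X t \<in> measurable L (count_space UNIV)"
    and cont: "\<And>\<omega> t. \<omega> \<in> space L \<Longrightarrow> 0 \<le> t \<Longrightarrow> continuous (at_right t) (\<lambda>u. real (X u \<omega>))"
    and \<tau>: "\<tau> \<in> borel_measurable L" "\<And>\<omega>. \<omega> \<in> space L \<Longrightarrow> 0 \<le> \<tau> \<omega>"
  shows "(\<lambda>\<omega>. X (\<tau> \<omega>) \<omega>) \<in> measurable L (count_space UNIV)"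
proof -
  note [measurable] = \<tau>(1)
  have "(\<lambda>\<omega>. X (grid (Suc n) (\<tau> \<omega>)) \<omega>) \<in> measurable L (count_space UNIV)" for n
    unfolding grid_def
    by (rule measurable_compose_countable[where f="\<lambda>i \<omega>. X (real i / real (Suc n)) \<omega>"])
       (auto intro!: X)
  then have "(\<lambda>\<omega>. real (X (grid (Suc n) (\<tau> \<omega>)) \<omega>)) \<in> borel_measurable L" for n
    by measurable
  moreover have "(\<lambda>n. real (X (grid (Suc n) (\<tau> \<omega>)) \<omega>)) \<longlonglongrightarrow> real (X (\<tau> \<omega>) \<omega>)" if "\<omega> \<in> space L" for \<omega>
    using that \<tau>(2)[OF that]
    by (intro right_continuous_nat_tendsto cont grid_tendsto grid_ge) auto
  ultimately have [measurable]: "(\<lambda>\<omega>. real (X (\<tau> \<omega>) \<omega>)) \<in> borel_measurable L"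
    by (rule borel_measurable_LIMSEQ_real[rotated])
  \<comment> \<open>The floor leads back from a real-valued limit to a variable with natural
    values.\<close>
  have "(\<lambda>\<omega>. nat \<lfloor>real (X (\<tau> \<omega>) \<omega>)\<rfloor>) \<in> measurable L (count_space UNIV)"
    by measurable
  then show ?thesis by simp
qed

text \<open>The grid points strictly below \<tau> are those with index less than
  \<open>nat \<lceil>\<tau> \<omega> * real d\<rceil>\<close>. Thus a sum up to the rounded time
  becomes a series of indicators, which can be integrated term by term.\<close>

lemma sum_indicator_less_grid:
  fixes f :: "nat \<Rightarrow> ennreal"
  assumes d: "0 < d" and \<omega>: "\<omega> \<in> Z"
  shows "(\<Sum>j. f j * indicator {\<omega>\<in>Z. real j / real d < \<tau> \<omega>} \<omega>) =
    (\<Sum>j<nat \<lceil>\<tau> \<omega> * real d\<rceil>. f j)"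
proof -
  have eq: "real j / real d < \<tau> \<omega> \<longleftrightarrow> j < nat \<lceil>\<tau> \<omega> * real d\<rceil>" for j
    using d by (simp add: divide_less_eq zless_nat_eq_int_zless less_ceiling_iff)
  show ?thesis
    unfolding indicator_def using \<omega>
    by (subst suminf_finite[of "{..<nat \<lceil>\<tau> \<omega> * real d\<rceil>}"]) (auto simp: eq intro!: sum.cong)
qed

lemma (in prob_space) poisson_wald_grid:
  assumes pp: "poisson_process M rate X" and rate: "0 < rate"
    and ind: "indep_set (gen_events M (count_space UNIV) {0..} X) (sets G)"
    and space: "space G = space M"
    and \<tau>: "\<tau> \<in> borel_measurable M"
    and stop: "\<And>t. 0 \<le> t \<Longrightarrow> \<exists>A\<in>sets (past M X G t). AE \<omega> in M. t < \<tau> \<omega> \<longleftrightarrow> \<omega> \<in> A"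
    and d: "0 < d"
  shows "(\<integral>\<^sup>+\<omega>. ennreal (real (X (grid d (\<tau> \<omega>)) \<omega>)) \<partial>M) =
    ennreal rate * (\<integral>\<^sup>+\<omega>. ennreal (grid d (\<tau> \<omega>)) \<partial>M)"
proof -
  let ?t = "\<lambda>j::nat. real j / real d"
  let ?inc = "\<lambda>j \<omega>. ennreal (real (X (?t (Suc j)) \<omega> - X (?t j) \<omega>))"
  let ?B = "\<lambda>j. {\<omega>\<in>space M. ?t j < \<tau> \<omega>}"
  note [measurable] = \<tau>
  have X [measurable]: "X (?t j) \<in> measurable M (count_space UNIV)" for j
    using pp d by (auto simp: poisson_process_def)
  have tt: "0 \<le> ?t j" "?t j < ?t (Suc j)" for j
    using d by (auto simp: divide_strict_right_mono)
  have X_grid: "ennreal (real (X (grid d (\<tau> \<omega>)) \<omega>)) = (\<Sum>j. ?inc j \<omega> * indicator (?B j) \<omega>)"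
    if "\<omega> \<in> space M" for \<omega>
  proof -
    let ?m = "nat \<lceil>\<tau> \<omega> * real d\<rceil>"
    have "X (?t ?m) \<omega> = (\<Sum>j<?m. X (?t (Suc j)) \<omega> - X (?t j) \<omega>)"
      using tt that less_imp_le[OF tt(2)]
      by (intro poisson_increments_determine_past[OF pp, where n = ?m]) auto
    then have "ennreal (real (X (?t ?m) \<omega>)) = (\<Sum>j<?m. ?inc j \<omega>)"
      by (simp add: sum_ennreal)
    then show ?thesis
      by (simp add: grid_def sum_indicator_less_grid[OF d that])
  qed
  have step: "(\<integral>\<^sup>+\<omega>. ?inc j \<omega> * indicator (?B j) \<omega> \<partial>M) =
      (\<integral>\<^sup>+\<omega>. ennreal (rate / real d) * indicator (?B j) \<omega> \<partial>M)" for j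
  proof -
    obtain A where A: "A \<in> sets (past M X G (?t j))" and AE: "AE \<omega> in M. ?t j < \<tau> \<omega> \<longleftrightarrow> \<omega> \<in> A"
      using stop[OF tt(1)] by blast
    note ind' = poisson_increment_indep[OF pp tt ind space, of j]
    have A_M: "A \<in> sets M"
      using indep_setD_ev2[OF ind'] A by auto
    let ?F = "vimage_algebra (space M) (\<lambda>\<omega>. X (?t (Suc j)) \<omega> - X (?t j) \<omega>) (count_space UNIV)"
    have "(\<lambda>\<omega>. X (?t (Suc j)) \<omega> - X (?t j) \<omega>) \<in> measurable ?F (count_space UNIV)"
      by (rule measurable_vimage_algebra1) auto
    then have inc: "?inc j \<in> borel_measurable ?F"
      by measurable
    have "(\<integral>\<^sup>+\<omega>. ?inc j \<omega> * indicator (?B j) \<omega> \<partial>M) = (\<integral>\<^sup>+\<omega>. ?inc j \<omega> * indicator A \<omega> \<partial>M)"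
      using AE by (intro nn_integral_cong_AE) (auto split: split_indicator)
    also have "\<dots> = (\<integral>\<^sup>+\<omega>. ?inc j \<omega> \<partial>M) * emeasure M A"
      by (rule nn_integral_indep_indicator[OF ind' _ _ inc A]) (auto simp: past_def space_measure_of_conv)
    also have "(\<integral>\<^sup>+\<omega>. ?inc j \<omega> \<partial>M) = ennreal (rate / real d)"
      using poisson_increment_mean[OF pp rate tt, of j] d by (simp add: diff_divide_distrib[symmetric])
    also have "emeasure M A = emeasure M (?B j)"
      using AE A_M by (intro emeasure_eq_AE) auto
    finally show ?thesis
      by (simp add: nn_integral_cmult)
  qed
  have "(\<integral>\<^sup>+\<omega>. ennreal (real (X (grid d (\<tau> \<omega>)) \<omega>)) \<partial>M) =
      (\<integral>\<^sup>+\<omega>. (\<Sum>j. ?inc j \<omega> * indicator (?B j) \<omega>) \<partial>M)"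
    by (intro nn_integral_cong X_grid)
  also have "\<dots> = (\<Sum>j. \<integral>\<^sup>+\<omega>. ?inc j \<omega> * indicator (?B j) \<omega> \<partial>M)"
    by (intro nn_integral_suminf) measurable
  also have "\<dots> = (\<integral>\<^sup>+\<omega>. (\<Sum>j. ennreal (rate / real d) * indicator (?B j) \<omega>) \<partial>M)"
    unfolding step by (intro nn_integral_suminf[symmetric]) measurable
  also have "\<dots> = (\<integral>\<^sup>+\<omega>. ennreal rate * ennreal (grid d (\<tau> \<omega>)) \<partial>M)"
  proof (intro nn_integral_cong)
    fix \<omega> assume "\<omega> \<in> space M"
    then show "(\<Sum>j. ennreal (rate / real d) * indicator (?B j) \<omega>) = ennreal rate * ennreal (grid d (\<tau> \<omega>))"
      unfolding sum_indicator_less_grid[OF d \<open>\<omega> \<in> space M\<close>]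
      using rate d
      by (simp add: grid_def ennreal_of_nat_eq_real_of_nat ennreal_mult[symmetric])
  qed
  also have "\<dots> = ennreal rate * (\<integral>\<^sup>+\<omega>. ennreal (grid d (\<tau> \<omega>)) \<partial>M)"
    by (intro nn_integral_cmult) (auto simp: grid_def)
  finally show ?thesis .
qed

text \<open>The mesh of the grid tends to 0. Both sides converge by dominated convergence: times
  and, since paths are monotone, counts are bounded by their values at mesh 1, which are integrable
  by the identity on the grid.\<close>

lemma (in prob_space) poisson_wald:
  assumes pp: "poisson_process M rate X" and rate: "0 < rate"
    and ind: "indep_set (gen_events M (count_space UNIV) {0..} X) (sets G)"
    and space: "space G = space M"
    and \<tau>: "integrable M \<tau>" and nn: "\<And>\<omega>. \<omega> \<in> space M \<Longrightarrow> 0 \<le> \<tau> \<omega>"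
    and stop: "\<And>t. 0 \<le> t \<Longrightarrow> \<exists>A\<in>sets (past M X G t). AE \<omega> in M. t < \<tau> \<omega> \<longleftrightarrow> \<omega> \<in> A"
  shows "integrable M (\<lambda>\<omega>. real (X (\<tau> \<omega>) \<omega>))"
    and "(\<integral>\<omega>. real (X (\<tau> \<omega>) \<omega>) \<partial>M) = rate * (\<integral>\<omega>. \<tau> \<omega> \<partial>M)"
proof -
  let ?g = "\<lambda>d \<omega>. grid d (\<tau> \<omega>)" and ?x = "\<lambda>d \<omega>. real (X (grid d (\<tau> \<omega>)) \<omega>)"
  have \<tau>M [measurable]: "\<tau> \<in> borel_measurable M"
    using \<tau> by simp
  have XM: "X t \<in> measurable M (count_space UNIV)" if "0 \<le> t" for t
    using pp that by (simp add: poisson_process_def)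
  have cont: "continuous (at_right t) (\<lambda>u. real (X u \<omega>))" if "\<omega> \<in> space M" "0 \<le> t" for \<omega> t
    using pp that by (simp add: poisson_process_def)
  have gM [measurable]: "?g d \<in> borel_measurable M" for d
    unfolding grid_def by measurable
  have g0: "0 \<le> grid d y" for d y by (simp add: grid_def)
  have eval: "(\<lambda>\<omega>. X (\<sigma> \<omega>) \<omega>) \<in> measurable M (count_space UNIV)"
    if "\<sigma> \<in> borel_measurable M" "\<And>\<omega>. \<omega> \<in> space M \<Longrightarrow> 0 \<le> \<sigma> \<omega>" for \<sigma>
    using XM cont that by (rule measurable_right_continuous_eval)
  have [measurable]: "(\<lambda>\<omega>. X (?g d \<omega>) \<omega>) \<in> measurable M (count_space UNIV)" for d
    using g0 by (intro eval) auto
  have [measurable]: "(\<lambda>\<omega>. X (\<tau> \<omega>) \<omega>) \<in> measurable M (count_space UNIV)"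
    using nn by (intro eval) auto
  have gI: "integrable M (?g d)" if "0 < d" for d
  proof (rule Bochner_Integration.integrable_bound[OF Bochner_Integration.integrable_add[OF \<tau> integrable_const[of "1 / real d"]]])
    show "AE \<omega> in M. norm (?g d \<omega>) \<le> norm (\<tau> \<omega> + 1 / real d)"
    proof (intro AE_I2)
      fix \<omega> assume "\<omega> \<in> space M"
      then have "0 \<le> ?g d \<omega>" "?g d \<omega> \<le> \<tau> \<omega> + 1 / real d"
        using grid_le[OF that nn] g0 by auto
      then show "norm (?g d \<omega>) \<le> norm (\<tau> \<omega> + 1 / real d)" by simp
    qed
  qed simp
  have x: "integrable M (?x d) \<and> (\<integral>\<omega>. ?x d \<omega> \<partial>M) = rate * (\<integral>\<omega>. ?g d \<omega> \<partial>M)" if "0 < d" for d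
  proof -
    have "0 \<le> (\<integral>\<omega>. ?g d \<omega> \<partial>M)"
      using g0 by simp
    have "(\<integral>\<^sup>+\<omega>. ennreal (?x d \<omega>) \<partial>M) = ennreal rate * (\<integral>\<^sup>+\<omega>. ennreal (?g d \<omega>) \<partial>M)"
      using poisson_wald_grid[OF pp rate ind space \<tau>M stop that] .
    also have "(\<integral>\<^sup>+\<omega>. ennreal (?g d \<omega>) \<partial>M) = ennreal (\<integral>\<omega>. ?g d \<omega> \<partial>M)"
      using gI[OF that] g0 by (intro nn_integral_eq_integral) auto
    also have "ennreal rate * \<dots> = ennreal (rate * (\<integral>\<omega>. ?g d \<omega> \<partial>M))"
      using rate \<open>0 \<le> (\<integral>\<omega>. ?g d \<omega> \<partial>M)\<close> by (simp add: ennreal_mult)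
    finally show ?thesis
      using rate \<open>0 \<le> (\<integral>\<omega>. ?g d \<omega> \<partial>M)\<close> by (subst (asm) nn_integral_eq_integrable) auto
  qed
  have mono: "mono_on {0..} (\<lambda>t. X t \<omega>)" if "\<omega> \<in> space M" for \<omega>
    using pp that by (simp add: poisson_process_def)
  have lim_g: "AE \<omega> in M. (\<lambda>n. ?g (Suc n) \<omega>) \<longlonglongrightarrow> \<tau> \<omega>"
    using nn by (intro AE_I2 grid_tendsto) auto
  have lim_x: "AE \<omega> in M. (\<lambda>n. ?x (Suc n) \<omega>) \<longlonglongrightarrow> real (X (\<tau> \<omega>) \<omega>)"
    using nn by (intro AE_I2 right_continuous_nat_tendsto cont grid_tendsto grid_ge) auto
  have bd_g: "AE \<omega> in M. norm (?g (Suc n) \<omega>) \<le> ?g 1 \<omega>" for n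
    using nn g0 grid_le_grid_1[of "Suc n"] by (intro AE_I2) auto
  have bd_x: "AE \<omega> in M. norm (?x (Suc n) \<omega>) \<le> ?x 1 \<omega>" for n
    using nn g0 grid_le_grid_1[of "Suc n"] by (intro AE_I2) (auto intro!: mono_onD[OF mono])
  note dom_g = integral_dominated_convergence[OF _ _ gI lim_g bd_g]
  note dom_x = integrable_dominated_convergence[OF _ _ _ lim_x bd_x]
    integral_dominated_convergence[OF _ _ _ lim_x bd_x]
  show "integrable M (\<lambda>\<omega>. real (X (\<tau> \<omega>) \<omega>))"
    using x[of 1] by (intro dom_x(1)) auto
  have "(\<lambda>n. \<integral>\<omega>. ?g (Suc n) \<omega> \<partial>M) \<longlonglongrightarrow> (\<integral>\<omega>. \<tau> \<omega> \<partial>M)"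
    by (rule dom_g) auto
  then have "(\<lambda>n. rate * (\<integral>\<omega>. ?g (Suc n) \<omega> \<partial>M)) \<longlonglongrightarrow> rate * (\<integral>\<omega>. \<tau> \<omega> \<partial>M)"
    by (rule tendsto_mult_left)
  moreover have "(\<lambda>n. \<integral>\<omega>. ?x (Suc n) \<omega> \<partial>M) \<longlonglongrightarrow> (\<integral>\<omega>. real (X (\<tau> \<omega>) \<omega>) \<partial>M)"
    using x[of 1] by (intro dom_x(2)) auto
  ultimately show "(\<integral>\<omega>. real (X (\<tau> \<omega>) \<omega>) \<partial>M) = rate * (\<integral>\<omega>. \<tau> \<omega> \<partial>M)"
    using x by (simp add: LIMSEQ_unique)
qed

lemma measurable_gen_events:
  assumes "gen_events M B T X \<subseteq> sets L" "space L = space M" "t \<in> T"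
    and "\<And>\<omega>. \<omega> \<in> space M \<Longrightarrow> X t \<omega> \<in> space B"
  shows "X t \<in> measurable L B"
proof (rule measurableI)
  fix A assume "A \<in> sets B"
  then show "X t -` A \<inter> space L \<in> sets L"
    using assms vimage_in_gen_events[of t T A B X M] by auto
qed (use assms in auto)

text \<open>To the right of \<open>x < t\<close> the stopped path agrees with \<open>f\<close> near
  \<open>x\<close>; to the right of \<open>x \<ge> t\<close> it is constant.\<close>

lemma continuous_at_right_stopped:
  fixes f :: "real \<Rightarrow> nat"
  assumes "continuous (at_right x) (\<lambda>u. real (f u))"
  shows "continuous (at_right x) (\<lambda>u. real (f (min u t)))"
proof (cases "x < t")
  case True
  have ev: "\<forall>\<^sub>F u in at_right x. real (f u) = real (f (min u t))"
    using True by (subst eventually_at_right[OF True]) (auto intro!: exI[of _ t])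
  have "((\<lambda>u. real (f u)) \<longlongrightarrow> real (f x)) (at_right x)"
    using assms by (simp add: continuous_within)
  then have "((\<lambda>u. real (f (min u t))) \<longlongrightarrow> real (f x)) (at_right x)"
    using ev by (rule Lim_transform_eventually)
  then show ?thesis
    using True by (simp add: continuous_within)
next
  case False
  have ev: "\<forall>\<^sub>F u in at_right x. real (f t) = real (f (min u t))"
    using False by (subst eventually_at_right[of x "x + 1"]) (auto intro!: exI[of _ "x + 1"])
  have "((\<lambda>u. real (f (min u t))) \<longlongrightarrow> real (f t)) (at_right x)"
    using tendsto_const ev by (rule Lim_transform_eventually)
  then show ?thesis
    using False by (simp add: continuous_within)
qed

section \<open>Sample paths and stopping\<close>

context bep_polling_system
begin

text \<open>
  The arrival processes are a parameter \<open>Z\<close> below: whether an epoch lies before \<open>t\<close> is decided by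
  the processes stopped at \<open>t\<close>, which gives the stopping time property.
\<close>

definition visited :: "nat \<Rightarrow> nat" where
  "visited m = p (stage I m)"

definition epoch :: "(nat \<Rightarrow> real \<Rightarrow> 'a \<Rightarrow> nat) \<Rightarrow> nat \<Rightarrow> 'a \<Rightarrow> real" where
  "epoch Z m \<omega> = fst (polling_state I p Z S V Y Q0 m \<omega>)"

definition content :: "(nat \<Rightarrow> real \<Rightarrow> 'a \<Rightarrow> nat) \<Rightarrow> nat \<Rightarrow> 'a \<Rightarrow> nat \<Rightarrow> nat" where
  "content Z m \<omega> = snd (polling_state I p Z S V Y Q0 m \<omega>)"

definition quota :: "(nat \<Rightarrow> real \<Rightarrow> 'a \<Rightarrow> nat) \<Rightarrow> nat \<Rightarrow> 'a \<Rightarrow> nat" where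
  "quota Z m \<omega> = Y m (content Z m \<omega> (visited m)) \<omega>"

definition completion :: "(nat \<Rightarrow> real \<Rightarrow> 'a \<Rightarrow> nat) \<Rightarrow> nat \<Rightarrow> nat \<Rightarrow> 'a \<Rightarrow> real" where
  "completion Z m n \<omega> = epoch Z m \<omega> + (\<Sum>j<n. S m j \<omega>)"

text \<open>
  The level condition \<open>x + arrivals - n = x - Y\<close> of \<open>num_services\<close>, solved for \<open>n\<close>: the count \<open>x\<close>
  cancels, and no signed arithmetic is needed.
\<close>

definition hit :: "(nat \<Rightarrow> real \<Rightarrow> 'a \<Rightarrow> nat) \<Rightarrow> nat \<Rightarrow> nat \<Rightarrow> 'a \<Rightarrow> bool" where
  "hit Z m n \<omega> \<longleftrightarrow>
    n = quota Z m \<omega> + (Z (visited m) (completion Z m n \<omega>) \<omega> - Z (visited m) (epoch Z m \<omega>) \<omega>)"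

text \<open>
  A visit is stopped at the first \<open>n\<close> that is in \<open>D\<close> or reaches the level: \<open>D = {}\<close> is the visit of
  the model, \<open>D = {J}\<close> its truncation after \<open>J\<close> services. If \<open>ends\<close> fails, \<open>served\<close> is a junk value
  that may depend on arrivals after any given time.
\<close>

definition served :: "nat set \<Rightarrow> (nat \<Rightarrow> real \<Rightarrow> 'a \<Rightarrow> nat) \<Rightarrow> nat \<Rightarrow> 'a \<Rightarrow> nat" where
  "served D Z m \<omega> = (LEAST n. n \<in> D \<or> hit Z m n \<omega>)"

definition ends :: "nat set \<Rightarrow> (nat \<Rightarrow> real \<Rightarrow> 'a \<Rightarrow> nat) \<Rightarrow> nat \<Rightarrow> 'a \<Rightarrow> bool" where
  "ends D Z m \<omega> \<longleftrightarrow> (\<exists>n. n \<in> D \<or> hit Z m n \<omega>)"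

definition departure :: "nat set \<Rightarrow> (nat \<Rightarrow> real \<Rightarrow> 'a \<Rightarrow> nat) \<Rightarrow> nat \<Rightarrow> 'a \<Rightarrow> real" where
  "departure D Z m \<omega> = completion Z m (served D Z m \<omega>) \<omega>"

lemma epoch_0: "epoch Z 0 \<omega> = 0"
  and content_0: "content Z 0 \<omega> k = Q0 k \<omega>"
  by (simp_all add: epoch_def content_def)

lemma num_services_eq_served:
  "num_services (\<lambda>t. Z (visited m) t \<omega>) (\<lambda>j. S m j \<omega>) (epoch Z m \<omega>)
     (content Z m \<omega> (visited m)) (quota Z m \<omega>) = served {} Z m \<omega>"
  unfolding num_services_def served_def hit_def completion_def
  by (intro arg_cong[where f=Least] ext) auto

lemma epoch_Suc: "epoch Z (Suc m) \<omega> = departure {} Z m \<omega> + V m \<omega>"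
  and content_Suc: "content Z (Suc m) \<omega> k = content Z m \<omega> k +
    (Z k (epoch Z (Suc m) \<omega>) \<omega> - Z k (epoch Z m \<omega>) \<omega>) - (if k = visited m then served {} Z m \<omega> else 0)"
proof -
  obtain a x where ax: "polling_state I p Z S V Y Q0 m \<omega> = (a, x)" by fastforce
  note n = num_services_eq_served[of Z m \<omega>, unfolded quota_def epoch_def content_def ax visited_def, simplified]
  show "epoch Z (Suc m) \<omega> = departure {} Z m \<omega> + V m \<omega>"
    by (simp add: departure_def completion_def epoch_def ax n Let_def)
  then show "content Z (Suc m) \<omega> k = content Z m \<omega> k +
    (Z k (epoch Z (Suc m) \<omega>) \<omega> - Z k (epoch Z m \<omega>) \<omega>) - (if k = visited m then served {} Z m \<omega> else 0)"
    by (simp add: departure_def completion_def epoch_def content_def ax n Let_def visited_def)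
qed

lemma I_pos: "0 < I"
  using K_pos K_le_I by simp

lemma stage_in: "stage I m \<in> {1..I}"
  using I_pos by (auto simp: stage_def Suc_le_eq)

lemma visited_in: "visited m \<in> {1..K}"
  unfolding visited_def by (rule table[OF stage_in])

lemma completion_mono:
  "\<omega> \<in> space M \<Longrightarrow> n \<le> n' \<Longrightarrow> completion Z m n \<omega> \<le> completion Z m n' \<omega>"
  unfolding completion_def using services_nonneg by (auto intro!: sum_mono2)

lemma epoch_le_completion: "\<omega> \<in> space M \<Longrightarrow> epoch Z m \<omega> \<le> completion Z m n \<omega>"
  unfolding completion_def using services_nonneg by (auto intro!: sum_nonneg)

lemma epoch_le_departure: "\<omega> \<in> space M \<Longrightarrow> epoch Z m \<omega> \<le> departure D Z m \<omega>"
  unfolding departure_def by (rule epoch_le_completion)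

lemma departure_le_epoch: "\<omega> \<in> space M \<Longrightarrow> departure {} Z m \<omega> \<le> epoch Z (Suc m) \<omega>"
  unfolding epoch_Suc using switchovers_nonneg by simp

lemma epoch_nonneg: "\<omega> \<in> space M \<Longrightarrow> 0 \<le> epoch Z m \<omega>"
proof (induction m)
  case (Suc m)
  then show ?case
    using epoch_le_departure[OF Suc.prems, of Z m "{}"] departure_le_epoch[OF Suc.prems, of Z m] by linarith
qed (simp add: epoch_0)

lemma served_least:
  assumes "ends D Z m \<omega>"
  shows "served D Z m \<omega> \<in> D \<or> hit Z m (served D Z m \<omega>) \<omega>"
    and "n < served D Z m \<omega> \<Longrightarrow> n \<notin> D \<and> \<not> hit Z m n \<omega>"
  using assms LeastI_ex[of "\<lambda>n. n \<in> D \<or> hit Z m n \<omega>"] not_less_Least[of n "\<lambda>n. n \<in> D \<or> hit Z m n \<omega>"]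
  unfolding served_def ends_def by auto

text \<open>Service \<open>j\<close> takes place exactly if no level up to \<open>j\<close> stops
  the visit. These levels involve only the durations of services before \<open>j\<close>, which is
  what Wald's argument for the service times requires.\<close>

lemma less_served_iff:
  assumes "ends D Z m \<omega>"
  shows "j < served D Z m \<omega> \<longleftrightarrow> (\<forall>n\<le>j. n \<notin> D \<and> \<not> hit Z m n \<omega>)"
  using served_least[OF assms] by (meson le_less_trans not_le)

section \<open>Dependence of the sample path on arrivals up to a given time\<close>

definition agree_upto :: "real \<Rightarrow> 'a \<Rightarrow> (nat \<Rightarrow> real \<Rightarrow> 'a \<Rightarrow> nat) \<Rightarrow> (nat \<Rightarrow> real \<Rightarrow> 'a \<Rightarrow> nat) \<Rightarrow> bool" where
  "agree_upto t \<omega> Z' Z \<longleftrightarrow> (\<forall>k. \<forall>u\<in>{0..t}. Z' k u \<omega> = Z k u \<omega>)"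

lemma agree_uptoD: "agree_upto t \<omega> Z' Z \<Longrightarrow> 0 \<le> u \<Longrightarrow> u \<le> t \<Longrightarrow> Z' k u \<omega> = Z k u \<omega>"
  by (simp add: agree_upto_def)

text \<open>All levels up to the stopping one are tested at times no later than the departure, hence
  where the two families of paths coincide; so the first level that stops the visit is the
  same.\<close>

lemma visit_agree:
  assumes \<omega>: "\<omega> \<in> space M" and Z: "agree_upto t \<omega> Z' Z"
    and st: "epoch Z' m \<omega> = epoch Z m \<omega>" "content Z' m \<omega> = content Z m \<omega>"
    and e: "ends D Z m \<omega>" and t: "departure D Z m \<omega> \<le> t"
  shows "ends D Z' m \<omega> \<and> served D Z' m \<omega> = served D Z m \<omega> \<and> departure D Z' m \<omega> = departure D Z m \<omega>"
proof -
  let ?n = "served D Z m \<omega>"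
  have hit: "hit Z' m n \<omega> \<longleftrightarrow> hit Z m n \<omega>" if "n \<le> ?n" for n
  proof -
    have "completion Z m n \<omega> \<le> t"
      using completion_mono[OF \<omega> that, of Z m] t by (simp add: departure_def)
    then have "Z' (visited m) (completion Z m n \<omega>) \<omega> = Z (visited m) (completion Z m n \<omega>) \<omega>"
      "Z' (visited m) (epoch Z m \<omega>) \<omega> = Z (visited m) (epoch Z m \<omega>) \<omega>"
      using epoch_nonneg[OF \<omega>, of Z m] epoch_le_completion[OF \<omega>, of Z m n] by (auto intro!: agree_uptoD[OF Z])
    then show ?thesis
      by (simp add: hit_def quota_def completion_def st)
  qed
  have "served D Z' m \<omega> = ?n"
    unfolding served_def[of D Z']
  proof (rule Least_equality)
    show "?n \<in> D \<or> hit Z' m ?n \<omega>"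
      using served_least(1)[OF e] hit by auto
    show "?n \<le> n" if "n \<in> D \<or> hit Z' m n \<omega>" for n
      using served_least(2)[OF e, of n] hit[of n] that by (meson not_le less_imp_le)
  qed
  moreover have "ends D Z' m \<omega>"
    using served_least(1)[OF e] hit[of ?n] by (auto simp: ends_def)
  ultimately show ?thesis
    by (simp add: departure_def completion_def st)
qed

text \<open>On such paths the state at visit \<open>m\<close> involves no junk value of
  \<open>served\<close>.\<close>

definition regular :: "(nat \<Rightarrow> real \<Rightarrow> 'a \<Rightarrow> nat) \<Rightarrow> nat \<Rightarrow> 'a \<Rightarrow> bool" where
  "regular Z m \<omega> \<longleftrightarrow> (\<forall>m'<m. ends {} Z m' \<omega>)"

lemma regular_Suc: "regular Z (Suc m) \<omega> \<longleftrightarrow> regular Z m \<omega> \<and> ends {} Z m \<omega>"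
  by (auto simp: regular_def less_Suc_eq)

text \<open>Induction over the visits with \<open>visit_agree\<close>. Regularity is part of the
  conclusion because the result is later applied with the two families exchanged.\<close>

lemma state_agree:
  assumes \<omega>: "\<omega> \<in> space M" and Z: "agree_upto t \<omega> Z' Z"
    and "regular Z m \<omega>" "epoch Z m \<omega> \<le> t"
  shows "regular Z' m \<omega> \<and> epoch Z' m \<omega> = epoch Z m \<omega> \<and> content Z' m \<omega> = content Z m \<omega>"
  using assms(3,4)
proof (induction m)
  case 0
  then show ?case by (auto simp: regular_def epoch_0 content_0)
next
  case (Suc m)
  have le: "epoch Z m \<omega> \<le> t" "departure {} Z m \<omega> \<le> t"
    using Suc.prems epoch_le_departure[OF \<omega>, of Z m "{}"] departure_le_epoch[OF \<omega>, of Z m] by auto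
  have r: "regular Z m \<omega>" "ends {} Z m \<omega>"
    using Suc.prems by (auto simp: regular_Suc)
  have IH: "regular Z' m \<omega>" "epoch Z' m \<omega> = epoch Z m \<omega>" "content Z' m \<omega> = content Z m \<omega>"
    using Suc.IH[OF r(1) le(1)] by auto
  have v: "ends {} Z' m \<omega>" "served {} Z' m \<omega> = served {} Z m \<omega>" "departure {} Z' m \<omega> = departure {} Z m \<omega>"
    using visit_agree[OF \<omega> Z IH(2,3) r(2) le(2)] by auto
  have e: "epoch Z' (Suc m) \<omega> = epoch Z (Suc m) \<omega>"
    using v by (simp add: epoch_Suc)
  moreover have "content Z' (Suc m) \<omega> = content Z (Suc m) \<omega>"
    using epoch_nonneg[OF \<omega>, of Z] Suc.prems le
    by (intro ext) (simp add: content_Suc e v IH agree_uptoD[OF Z])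
  ultimately show ?case
    using IH v by (simp add: regular_Suc)
qed

text \<open>Applied in both directions, this shows that arrivals up to \<open>t\<close> decide
  whether the path is regular, the visit ends and its departure, delayed by \<open>v\<close>, occurs
  by \<open>t\<close>.\<close>

lemma departure_le_agree:
  assumes \<omega>: "\<omega> \<in> space M" and Z: "agree_upto t \<omega> Z' Z"
    and v: "0 \<le> v" and "regular Z m \<omega>" "ends D Z m \<omega>" "departure D Z m \<omega> + v \<le> t"
  shows "regular Z' m \<omega> \<and> ends D Z' m \<omega> \<and> departure D Z' m \<omega> + v \<le> t"
proof -
  have le: "departure D Z m \<omega> \<le> t" "epoch Z m \<omega> \<le> t"
    using assms epoch_le_departure[OF \<omega>, of Z m D] by auto
  have st: "regular Z' m \<omega>" "epoch Z' m \<omega> = epoch Z m \<omega>" "content Z' m \<omega> = content Z m \<omega>"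
    using state_agree[OF \<omega> Z] assms le by auto
  then show ?thesis
    using visit_agree[OF \<omega> Z st(2,3), of D] assms le by auto
qed

subsection \<open>Independence and measurability\<close>

definition source_sets :: "source \<Rightarrow> 'a set set" where
  "source_sets w = source_events M K N S V Y Q0 w"

definition others :: "source \<Rightarrow> 'a measure" where
  "others z = sigma (space M) (\<Union>w\<in>sources K - {z}. source_sets w)"

lemma source_sets_space: "source_sets w \<subseteq> Pow (space M)"
  unfolding source_sets_def by (cases w) (simp_all add: gen_events_space)

lemma Int_stable_source_sets: "Int_stable (source_sets w)"
  unfolding source_sets_def by (cases w) (simp_all add: Int_stable_gen_events)

lemma space_others: "space (others z) = space M"
  by (simp add: others_def space_measure_of_conv)

lemma sets_others: "sets (others z) = sigma_sets (space M) (\<Union>w\<in>sources K - {z}. source_sets w)"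
  unfolding others_def using source_sets_space by (intro sets_measure_of) auto

lemma source_sets_subset_others: "w \<in> sources K \<Longrightarrow> w \<noteq> z \<Longrightarrow> source_sets w \<subseteq> sets (others z)"
  unfolding sets_others by (auto intro: sigma_sets.Basic)

lemma sources_simps [simp]:
  "Service m j \<in> sources K" "Switchover m \<in> sources K" "Selection m \<in> sources K"
  "Initial \<in> sources K" "Arrivals k \<in> sources K \<longleftrightarrow> k \<in> {1..K}"
  by (auto simp: sources_def)

text \<open>The event sets of the sources are intersection-stable, so independence survives grouping
  them into \<open>z\<close> and the rest.\<close>

lemma indep_others:
  assumes z: "z \<in> sources K"
  shows "indep_set (source_sets z) (sets (others z))"
proof -
  have "(\<Union>b\<in>UNIV. case_bool {z} (sources K - {z}) b) = sources K"
    using z by (auto simp: UNIV_bool)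
  then have "indep_sets source_sets (\<Union>b\<in>UNIV. case_bool {z} (sources K - {z}) b)"
    using independence by (simp add: source_sets_def[abs_def])
  then have "indep_sets (\<lambda>b. sigma_sets (space M) (\<Union>w\<in>case_bool {z} (sources K - {z}) b. source_sets w)) UNIV"
    by (rule indep_sets_collect_sigma)
       (auto simp: disjoint_family_on_def UNIV_bool Int_stable_source_sets)
  then show ?thesis
    unfolding indep_set_def
    by (rule indep_sets_mono_sets) (auto split: bool.splits simp: sets_others intro: sigma_sets.Basic)
qed

definition knows :: "'a measure \<Rightarrow> nat \<Rightarrow> bool" where
  "knows L m \<longleftrightarrow> (\<forall>j. source_sets (Service m j) \<subseteq> sets L) \<and>
    source_sets (Switchover m) \<subseteq> sets L \<and> source_sets (Selection m) \<subseteq> sets L"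

text \<open>\<open>L\<close> is a single sigma-algebra, not a filtration; \<open>Z\<close> will be
  \<open>N\<close> itself or \<open>N\<close> with one path stopped. Right-continuity is included so
  that paths can be evaluated at random epochs.\<close>

definition adapted :: "'a measure \<Rightarrow> (nat \<Rightarrow> real \<Rightarrow> 'a \<Rightarrow> nat) \<Rightarrow> bool" where
  "adapted L Z \<longleftrightarrow> space L = space M \<and> source_sets Initial \<subseteq> sets L \<and>
    (\<forall>k\<in>{1..K}. \<forall>t\<ge>0. Z k t \<in> measurable L (count_space UNIV) \<and>
       (\<forall>\<omega>\<in>space M. continuous (at_right t) (\<lambda>u. real (Z k u \<omega>))))"

lemma measurable_sources:
  assumes "space L = space M"
  shows measurable_service: "source_sets (Service m j) \<subseteq> sets L \<Longrightarrow> S m j \<in> borel_measurable L"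
    and measurable_switchover: "source_sets (Switchover m) \<subseteq> sets L \<Longrightarrow> V m \<in> borel_measurable L"
    and measurable_selection: "source_sets (Selection m) \<subseteq> sets L \<Longrightarrow> Y m n \<in> measurable L (count_space UNIV)"
    and measurable_initial: "source_sets Initial \<subseteq> sets L \<Longrightarrow> k \<in> {1..K} \<Longrightarrow> Q0 k \<in> measurable L (count_space UNIV)"
    and measurable_arrivals: "source_sets (Arrivals k) \<subseteq> sets L \<Longrightarrow> 0 \<le> t \<Longrightarrow> N k t \<in> measurable L (count_space UNIV)"
  unfolding source_sets_def source_events.simps
  using assms by (auto elim: measurable_gen_events)

lemma adapted_eval:
  assumes "adapted L Z" "k \<in> {1..K}" "\<tau> \<in> borel_measurable L" "\<And>\<omega>. \<omega> \<in> space M \<Longrightarrow> 0 \<le> \<tau> \<omega>"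
  shows "(\<lambda>\<omega>. Z k (\<tau> \<omega>) \<omega>) \<in> measurable L (count_space UNIV)"
  using assms by (intro measurable_right_continuous_eval[where X = "Z k" and \<tau> = \<tau>]) (auto simp: adapted_def)

text \<open>Only services before \<open>n\<close> are assumed to be known, so that the tests up to
  level \<open>n\<close> remain independent of service \<open>n\<close>.\<close>

lemma measurable_hit:
  assumes L: "adapted L Z"
    and e [measurable]: "epoch Z m \<in> borel_measurable L"
    and c: "\<And>k. k \<in> {1..K} \<Longrightarrow> (\<lambda>\<omega>. content Z m \<omega> k) \<in> measurable L (count_space UNIV)"
    and Y: "source_sets (Selection m) \<subseteq> sets L" and S: "\<And>j. j < n \<Longrightarrow> source_sets (Service m j) \<subseteq> sets L"
  shows "completion Z m n \<in> borel_measurable L" "Measurable.pred L (hit Z m n)"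
proof -
  have sp: "space L = space M" using L by (simp add: adapted_def)
  show co [measurable]: "completion Z m n \<in> borel_measurable L"
    unfolding completion_def using measurable_service[OF sp S] e by (intro borel_measurable_add borel_measurable_sum) auto
  have [measurable]: "quota Z m \<in> measurable L (count_space UNIV)"
    unfolding quota_def
    by (rule measurable_compose_countable[OF measurable_selection[OF sp Y] c[OF visited_in]])
  have [measurable]: "(\<lambda>\<omega>. Z (visited m) (epoch Z m \<omega>) \<omega>) \<in> measurable L (count_space UNIV)"
    by (rule adapted_eval[OF L visited_in e epoch_nonneg])
  have [measurable]: "(\<lambda>\<omega>. Z (visited m) (completion Z m n \<omega>) \<omega>) \<in> measurable L (count_space UNIV)"
    by (rule adapted_eval[OF L visited_in co order_trans[OF epoch_nonneg epoch_le_completion]])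
  show "Measurable.pred L (hit Z m n)"
    unfolding hit_def by measurable
qed

lemma measurable_visit:
  assumes L: "adapted L Z"
    and e [measurable]: "epoch Z m \<in> borel_measurable L"
    and c: "\<And>k. k \<in> {1..K} \<Longrightarrow> (\<lambda>\<omega>. content Z m \<omega> k) \<in> measurable L (count_space UNIV)"
    and k: "knows L m"
  shows "served D Z m \<in> measurable L (count_space UNIV)" "departure D Z m \<in> borel_measurable L"
    "Measurable.pred L (ends D Z m)"
proof -
  have kS: "source_sets (Selection m) \<subseteq> sets L" "source_sets (Service m j) \<subseteq> sets L" for j
    using k by (simp_all add: knows_def)
  note h [measurable] = measurable_hit[OF L e c kS]
  show s [measurable]: "served D Z m \<in> measurable L (count_space UNIV)"
    unfolding served_def[abs_def] by measurable
  show "departure D Z m \<in> borel_measurable L"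
    unfolding departure_def[abs_def] by (rule measurable_compose_countable[OF h(1) s])
  show "Measurable.pred L (ends D Z m)"
    unfolding ends_def[abs_def] by measurable
qed

text \<open>Only the sources of visits before \<open>m\<close> enter, besides arrivals and the
  initial state. Taking \<open>L\<close> as \<open>others z\<close> therefore makes the state at
  visit \<open>m\<close> independent of a service or selection \<open>z\<close> of that
  visit.\<close>

lemma measurable_state:
  assumes L: "adapted L Z" and kn: "\<And>m'. m' < m \<Longrightarrow> knows L m'"
  shows "epoch Z m \<in> borel_measurable L"
    and "k \<in> {1..K} \<Longrightarrow> (\<lambda>\<omega>. content Z m \<omega> k) \<in> measurable L (count_space UNIV)"
    and "Measurable.pred L (regular Z m)"
proof -
  have sp: "space L = space M" using L by (simp add: adapted_def)
  have "epoch Z m \<in> borel_measurable L \<and>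
      (\<forall>k\<in>{1..K}. (\<lambda>\<omega>. content Z m \<omega> k) \<in> measurable L (count_space UNIV)) \<and> Measurable.pred L (regular Z m)"
    using kn
  proof (induction m)
    case 0
    then show ?case
      using measurable_initial[OF sp] L by (auto simp: epoch_0[abs_def] content_0 regular_def[abs_def] adapted_def)
  next
    case (Suc m)
    then have e [measurable]: "epoch Z m \<in> borel_measurable L"
      and c: "\<And>k. k \<in> {1..K} \<Longrightarrow> (\<lambda>\<omega>. content Z m \<omega> k) \<in> measurable L (count_space UNIV)"
      and r [measurable]: "Measurable.pred L (regular Z m)" and kn: "knows L m"
      by auto
    note v [measurable] = measurable_visit[OF L e c kn, of "{}"]
    have [measurable]: "V m \<in> borel_measurable L"
      using kn by (intro measurable_switchover[OF sp]) (simp add: knows_def)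
    have e' [measurable]: "epoch Z (Suc m) \<in> borel_measurable L"
      unfolding epoch_Suc[abs_def] by measurable
    have "(\<lambda>\<omega>. content Z (Suc m) \<omega> k) \<in> measurable L (count_space UNIV)" if k: "k \<in> {1..K}" for k
    proof -
      note [measurable] = c[OF k] adapted_eval[OF L k e epoch_nonneg] adapted_eval[OF L k e' epoch_nonneg]
      show ?thesis unfolding content_Suc by measurable
    qed
    moreover have "Measurable.pred L (regular Z (Suc m))"
      unfolding regular_Suc[abs_def] by measurable
    ultimately show ?case using e' by auto
  qed
  then show "epoch Z m \<in> borel_measurable L"
    and "k \<in> {1..K} \<Longrightarrow> (\<lambda>\<omega>. content Z m \<omega> k) \<in> measurable L (count_space UNIV)"
    and "Measurable.pred L (regular Z m)" by auto
qed

lemma arrivals_continuous: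
  "k \<in> {1..K} \<Longrightarrow> \<omega> \<in> space M \<Longrightarrow> 0 \<le> t \<Longrightarrow> continuous (at_right t) (\<lambda>u. real (N k u \<omega>))"
  using arrivals by (simp add: poisson_process_def)

lemma adapted_arrivals:
  assumes "space L = space M" "source_sets Initial \<subseteq> sets L"
    and "\<And>k. k \<in> {1..K} \<Longrightarrow> source_sets (Arrivals k) \<subseteq> sets L"
  shows "adapted L N"
  unfolding adapted_def
  by (intro conjI ballI allI impI assms measurable_arrivals[OF assms(1) assms(3)] arrivals_continuous)

lemma source_sets_events: "w \<in> sources K \<Longrightarrow> source_sets w \<subseteq> events"
  using independence by (auto simp: indep_sets_def source_sets_def)

lemma adapted_M: "adapted M N" and knows_M: "knows M m"
  unfolding knows_def by (intro adapted_arrivals conjI allI source_sets_events refl; simp)+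

text \<open>With all other sources revealed at time 0, the delayed departure is almost surely a
  stopping time for the arrivals at queue \<open>k\<close>: stopping that arrival path at
  \<open>t\<close> does not change whether it occurs by \<open>t\<close>. Wald's identity then
  applies.\<close>

lemma departure_wald:
  fixes v :: "'a \<Rightarrow> real"
  assumes k: "k \<in> {1..K}"
    and AE: "AE \<omega> in M. regular N m \<omega> \<and> ends D N m \<omega>"
    and v: "v \<in> borel_measurable (others (Arrivals k))" "\<And>\<omega>. \<omega> \<in> space M \<Longrightarrow> 0 \<le> v \<omega>"
    and int: "integrable M (\<lambda>\<omega>. departure D N m \<omega> + v \<omega>)"
  shows "integrable M (\<lambda>\<omega>. real (N k (departure D N m \<omega> + v \<omega>) \<omega>))"
    and "(\<integral>\<omega>. real (N k (departure D N m \<omega> + v \<omega>) \<omega>) \<partial>M) = lam k * (\<integral>\<omega>. departure D N m \<omega> + v \<omega> \<partial>M)"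
proof -
  let ?G = "others (Arrivals k)"
  have ind: "indep_set (gen_events M (count_space UNIV) {0..} (N k)) (sets ?G)"
    using indep_others[of "Arrivals k"] k by (simp add: source_sets_def)
  have stop: "\<exists>A\<in>sets (past M (N k) ?G t). AE \<omega> in M. t < departure D N m \<omega> + v \<omega> \<longleftrightarrow> \<omega> \<in> A"
    if t: "0 \<le> t" for t
  proof -
    let ?L = "past M (N k) ?G t"
    \<comment> \<open>The path of queue \<open>k\<close> is frozen at \<open>t\<close>, which makes
      everything computed from \<open>Z\<close> measurable with respect to the past.\<close>
    define Z where "Z = N(k := \<lambda>u. N k (min u t))"
    have Z: "agree_upto t \<omega> Z N" "agree_upto t \<omega> N Z" for \<omega>
      by (auto simp: agree_upto_def Z_def min_def)
    have sp: "space ?L = space M" by (simp add: past_def space_measure_of_conv)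
    have gen: "gen_events M (count_space UNIV) {0..t} (N k) \<union> sets ?G \<subseteq> sets ?L"
      unfolding past_def using gen_events_space[of M "count_space UNIV" "{0..t}" "N k"] sets.space_closed[of ?G] space_others
      by (subst sets_measure_of) (auto intro: sigma_sets.Basic)
    have src: "source_sets w \<subseteq> sets ?L" if "w \<in> sources K" "w \<noteq> Arrivals k" for w
      using source_sets_subset_others[OF that] gen by auto
    have L: "adapted ?L Z"
      unfolding adapted_def
    proof (intro conjI ballI allI impI)
      fix j u assume j: "j \<in> {1..K}" and u: "0 \<le> (u::real)"
      show "Z j u \<in> measurable ?L (count_space UNIV)"
      proof (cases "j = k")
        case True
        have "N k (min u t) \<in> measurable ?L (count_space UNIV)"
          using u t gen sp by (intro measurable_gen_events[of M _ "{0..t}"]) auto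
        then show ?thesis using True by (simp add: Z_def)
      next
        case False
        then have "source_sets (Arrivals j) \<subseteq> sets ?L"
          using j by (intro src) auto
        then show ?thesis
          using False measurable_arrivals[OF sp _ u] by (simp add: Z_def)
      qed
      fix \<omega> assume "\<omega> \<in> space M"
      then have "continuous (at_right u) (\<lambda>u. real (N j u \<omega>))"
        using j u by (intro arrivals_continuous)
      then show "continuous (at_right u) (\<lambda>u. real (Z j u \<omega>))"
        using continuous_at_right_stopped[of u "\<lambda>u. N j u \<omega>" t] by (auto simp: Z_def)
    qed (use sp src in auto)
    have kn: "knows ?L m'" for m'
      unfolding knows_def by (intro conjI allI src) simp_all
    note st = measurable_state[OF L kn]
    note [measurable] = st measurable_visit[OF L st(1,2) kn, where D = D]
    have [measurable]: "v \<in> borel_measurable ?L"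
      by (rule measurable_from_subalg[OF _ v(1)]) (use gen sp space_others in \<open>auto simp: subalgebra_def\<close>)
    let ?A = "{\<omega>\<in>space ?L. \<not> (regular Z m \<omega> \<and> ends D Z m \<omega> \<and> departure D Z m \<omega> + v \<omega> \<le> t)}"
    have "?A \<in> sets ?L" by measurable
    moreover have "AE \<omega> in M. t < departure D N m \<omega> + v \<omega> \<longleftrightarrow> \<omega> \<in> ?A"
      using AE
    proof (rule AE_mp, intro AE_I2 impI)
      fix \<omega> assume \<omega>: "\<omega> \<in> space M" and g: "regular N m \<omega> \<and> ends D N m \<omega>"
      show "t < departure D N m \<omega> + v \<omega> \<longleftrightarrow> \<omega> \<in> ?A"
        using departure_le_agree[OF \<omega> Z(1) v(2)[OF \<omega>], of m D]
          departure_le_agree[OF \<omega> Z(2) v(2)[OF \<omega>], of m D] g \<omega>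
        unfolding mem_Collect_eq sp not_le[symmetric] by blast
    qed
    ultimately show ?thesis by blast
  qed
  have nn: "0 \<le> departure D N m \<omega> + v \<omega>" if "\<omega> \<in> space M" for \<omega>
    using epoch_nonneg[OF that, of N m] epoch_le_departure[OF that, of N m D] v(2)[OF that] by linarith
  note w = poisson_wald[OF arrivals[OF k] lam_pos[OF k] ind space_others int nn stop]
  show "integrable M (\<lambda>\<omega>. real (N k (departure D N m \<omega> + v \<omega>) \<omega>))" by (rule w(1))
  show "(\<integral>\<omega>. real (N k (departure D N m \<omega> + v \<omega>) \<omega>) \<partial>M) = lam k * (\<integral>\<omega>. departure D N m \<omega> + v \<omega> \<partial>M)"
    by (rule w(2))
qed

section \<open>First moments of selections and services\<close>

definition own :: "source \<Rightarrow> 'a measure" where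
  "own z = sigma (space M) (source_sets z)"

lemma space_own: "space (own z) = space M"
  by (simp add: own_def space_measure_of_conv)

lemma sets_own: "sets (own z) = source_sets z"
  unfolding own_def source_sets_def by (cases z) (simp_all add: sigma_gen_events)

lemma nn_integral_own_others:
  assumes "z \<in> sources K" "X \<in> borel_measurable (own z)" "A \<in> sets (others z)"
  shows "(\<integral>\<^sup>+\<omega>. X \<omega> * indicator A \<omega> \<partial>M) = (\<integral>\<^sup>+\<omega>. X \<omega> \<partial>M) * emeasure M A"
  using assms indep_others[of z]
  by (intro nn_integral_indep_indicator[of "own z" "others z"]) (simp_all add: space_own space_others sets_own)

lemma adapted_others:
  assumes "z \<noteq> Initial" "\<And>k. z \<noteq> Arrivals k"
  shows "adapted (others z) N"
proof (rule adapted_arrivals)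
  show "source_sets Initial \<subseteq> sets (others z)"
    using assms by (intro source_sets_subset_others) auto
  show "source_sets (Arrivals k) \<subseteq> sets (others z)" if "k \<in> {1..K}" for k
    using assms(2)[of k] that by (intro source_sets_subset_others) auto
qed (rule space_others)

lemma knows_others:
  assumes "\<And>j. z \<noteq> Service m j" "z \<noteq> Switchover m" "z \<noteq> Selection m"
  shows "knows (others z) m"
  unfolding knows_def
proof (intro conjI allI)
  show "source_sets (Service m j) \<subseteq> sets (others z)" for j
    using assms(1)[of j] by (intro source_sets_subset_others) auto
qed (use assms in \<open>auto intro!: source_sets_subset_others[THEN subsetD]\<close>)

lemma sets_others_events: "z \<in> sources K \<Longrightarrow> A \<in> sets (others z) \<Longrightarrow> A \<in> events"
  using indep_setD_ev2[OF indep_others] by blast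

lemmas measurable_state_M = measurable_state[OF adapted_M knows_M]
lemmas measurable_visit_M = measurable_visit[OF adapted_M measurable_state_M(1,2) knows_M]

lemma measurable_service_M [measurable]: "S m j \<in> borel_measurable M"
  using services by blast

lemma measurable_switchover_M [measurable]: "V m \<in> borel_measurable M"
  using switchovers by blast

lemma measurable_selection_M [measurable]: "Y m n \<in> measurable M (count_space UNIV)"
  using selections by blast

lemma measurable_quota_M [measurable]: "quota N m \<in> measurable M (count_space UNIV)"
  unfolding quota_def[abs_def]
  by (rule measurable_compose_countable[OF _ measurable_state_M(2)[OF visited_in]]) simp

lemma service_mean: "(\<integral>\<^sup>+\<omega>. ennreal (S m j \<omega>) \<partial>M) = ennreal (1 / mu (visited m))"
proof -
  have d: "distr M borel (S m j) = B (visited m)"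
    using services by (simp add: visited_def)
  have "integrable (distr M borel (S m j)) (\<lambda>x. x)" "(\<integral>x. x \<partial>distr M borel (S m j)) = 1 / mu (visited m)"
    unfolding d using service_law_mean[OF visited_in] by auto
  then have "integrable M (S m j)" "(\<integral>\<omega>. S m j \<omega> \<partial>M) = 1 / mu (visited m)"
    by (simp_all add: integrable_distr_eq integral_distr)
  then show ?thesis
    using services_nonneg by (subst nn_integral_eq_integral) auto
qed

lemma switchover_mean: "integrable M (V m)" "(\<integral>\<omega>. V m \<omega> \<partial>M) = s (stage I m)"
proof -
  have d: "distr M borel (V m) = W (stage I m)"
    using switchovers by simp
  have "integrable (distr M borel (V m)) (\<lambda>x. x)" "(\<integral>x. x \<partial>distr M borel (V m)) = s (stage I m)"
    unfolding d using switchover_law_mean[OF stage_in] by auto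
  then show "integrable M (V m)" "(\<integral>\<omega>. V m \<omega> \<partial>M) = s (stage I m)"
    by (simp_all add: integrable_distr_eq integral_distr)
qed

text \<open>Split according to the number \<open>n\<close> of customers found: this event is
  independent of \<open>Y m n\<close>, since the state at the epoch does not involve the selections
  of visit \<open>m\<close>.\<close>

lemma nn_integral_quota:
  "(\<integral>\<^sup>+\<omega>. ennreal (real (quota N m \<omega>)) \<partial>M) =
    ennreal (r (stage I m)) * (\<integral>\<^sup>+\<omega>. ennreal (real (content N m \<omega> (visited m))) \<partial>M)"
proof -
  let ?z = "Selection m" and ?x = "\<lambda>\<omega>. content N m \<omega> (visited m)"
  let ?r = "r (stage I m)"
  have r: "0 \<le> ?r" "?r \<le> 1" using r_bounds[OF stage_in] by auto
  define A where "A n = {\<omega>\<in>space M. ?x \<omega> = n}" for n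
  have x: "?x \<in> measurable (others ?z) (count_space UNIV)"
    by (rule measurable_state(2)[OF adapted_others knows_others visited_in]) auto
  have A: "A n \<in> sets (others ?z)" for n
    using measurable_sets[OF x, of "{n}"] by (simp add: A_def space_others vimage_def Int_def conj_commute)
  have AM [measurable]: "A n \<in> sets M" for n
    using sets_others_events[OF _ A] by simp
  have Yown: "(\<lambda>\<omega>. ennreal (real (Y m n \<omega>))) \<in> borel_measurable (own ?z)" for n
    using measurable_selection[OF space_own, of m ?z n] sets_own by simp
  have Ymean: "(\<integral>\<^sup>+\<omega>. ennreal (real (Y m n \<omega>)) \<partial>M) = ennreal (?r * real n)" for n
  proof -
    have "(\<integral>\<^sup>+\<omega>. ennreal (real (Y m n \<omega>)) \<partial>M) = (\<integral>\<^sup>+ y. ennreal (real y) \<partial>distr M (count_space UNIV) (Y m n))"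
      by (subst nn_integral_distr) auto
    also have "distr M (count_space UNIV) (Y m n) = measure_pmf (binomial_pmf n ?r)"
      using selections by blast
    finally show ?thesis using nn_integral_binomial_pmf[OF r] by simp
  qed
  have single: "(\<Sum>n. f n * indicator (A n) \<omega>) = f (?x \<omega>)" if "\<omega> \<in> space M" for f :: "nat \<Rightarrow> ennreal" and \<omega>
    using that by (subst suminf_finite[of "{?x \<omega>}"]) (auto simp: A_def)
  have "(\<integral>\<^sup>+\<omega>. ennreal (real (quota N m \<omega>)) \<partial>M) =
      (\<integral>\<^sup>+\<omega>. (\<Sum>n. ennreal (real (Y m n \<omega>)) * indicator (A n) \<omega>) \<partial>M)"
    by (intro nn_integral_cong) (simp add: single quota_def)
  also have "\<dots> = (\<Sum>n. \<integral>\<^sup>+\<omega>. ennreal (real (Y m n \<omega>)) * indicator (A n) \<omega> \<partial>M)"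
    by (intro nn_integral_suminf) measurable
  also have "\<dots> = (\<Sum>n. \<integral>\<^sup>+\<omega>. ennreal (?r * real n) * indicator (A n) \<omega> \<partial>M)"
    by (simp add: nn_integral_own_others[OF _ Yown A] Ymean nn_integral_cmult)
  also have "\<dots> = (\<integral>\<^sup>+\<omega>. (\<Sum>n. ennreal (?r * real n) * indicator (A n) \<omega>) \<partial>M)"
    by (intro nn_integral_suminf[symmetric]) measurable
  also have "\<dots> = (\<integral>\<^sup>+\<omega>. ennreal ?r * ennreal (real (?x \<omega>)) \<partial>M)"
    using r by (intro nn_integral_cong) (simp add: single ennreal_mult)
  also have "\<dots> = ennreal ?r * (\<integral>\<^sup>+\<omega>. ennreal (real (?x \<omega>)) \<partial>M)"
    using measurable_state_M(2)[OF visited_in] by (intro nn_integral_cmult) simp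
  finally show ?thesis .
qed

text \<open>The support of the binomial law gives the bound for each \<open>n\<close>, and
  countability gives it for the random \<open>n\<close> that occurs. It is needed to rule out
  truncation in the queue-length recursion.\<close>

lemma AE_quota_le: "AE \<omega> in M. quota N m \<omega> \<le> content N m \<omega> (visited m)"
proof -
  have "AE \<omega> in M. Y m n \<omega> \<le> n" for n
  proof -
    have "AE y in measure_pmf (binomial_pmf n (r (stage I m))). y \<le> n"
      using r_bounds[OF stage_in, of m] by (auto simp: AE_measure_pmf_iff set_pmf_binomial_eq split: if_splits)
    moreover have "distr M (count_space UNIV) (Y m n) = measure_pmf (binomial_pmf n (r (stage I m)))"
      using selections by blast
    ultimately have "AE y in distr M (count_space UNIV) (Y m n). y \<le> n"
      by (simp only:)
    then show ?thesis by (subst (asm) AE_distr_iff) auto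
  qed
  then have "AE \<omega> in M. \<forall>n. Y m n \<omega> \<le> n"
    by (simp add: AE_all_countable)
  then show ?thesis
    by eventually_elim (simp add: quota_def)
qed

text \<open>Wald's identity for the service times: the event that service \<open>j\<close> takes
  place depends on other sources only, hence is independent of the duration
  \<open>S m j\<close>.\<close>

lemma nn_integral_services:
  assumes AE: "AE \<omega> in M. ends D N m \<omega>"
  shows "(\<integral>\<^sup>+\<omega>. ennreal (\<Sum>j<served D N m \<omega>. S m j \<omega>) \<partial>M) =
    ennreal (1 / mu (visited m)) * (\<integral>\<^sup>+\<omega>. ennreal (real (served D N m \<omega>)) \<partial>M)"
proof -
  \<comment> \<open>If the visit ends, this is the event \<open>j < served D N m \<omega>\<close>,
    written without the junk value of \<open>served\<close>.\<close>
  define A where "A j = {\<omega>\<in>space M. \<forall>n\<in>{..j}. n \<notin> D \<and> \<not> hit N m n \<omega>}" for j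
  have A: "A j \<in> sets (others (Service m j))" for j
  proof -
    let ?L = "others (Service m j)"
    have L: "adapted ?L N" by (rule adapted_others) auto
    have kn: "knows ?L m'" if "m' < m" for m'
      using that by (intro knows_others) auto
    note st = measurable_state[OF L kn]
    have [measurable]: "Measurable.pred ?L (hit N m n)" if "n \<le> j" for n
      using that by (intro measurable_hit[OF L st(1,2)] source_sets_subset_others) auto
    have "{\<omega>\<in>space ?L. \<forall>n\<in>{..j}. n \<notin> D \<and> \<not> hit N m n \<omega>} \<in> sets ?L"
      by (intro sets.sets_Collect_finite_All) auto
    then show ?thesis by (simp only: A_def space_others)
  qed
  have [measurable]: "A j \<in> sets M" for j
    using sets_others_events[OF _ A] by simp
  have sum: "(\<Sum>j. f j * indicator (A j) \<omega>) = (\<Sum>j<served D N m \<omega>. f j)"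
    if "\<omega> \<in> space M" "ends D N m \<omega>" for f :: "nat \<Rightarrow> ennreal" and \<omega>
  proof -
    have iff: "\<omega> \<in> A j \<longleftrightarrow> j < served D N m \<omega>" for j
      unfolding A_def less_served_iff[OF that(2)] using that(1) by blast
    have "(\<Sum>j. f j * indicator (A j) \<omega>) = (\<Sum>j<served D N m \<omega>. f j * indicator (A j) \<omega>)"
      by (rule suminf_finite) (simp_all add: iff indicator_def)
    then show ?thesis by (simp add: iff indicator_def)
  qed
  have Sown: "(\<lambda>\<omega>. ennreal (S m j \<omega>)) \<in> borel_measurable (own (Service m j))" for j
    using measurable_service[OF space_own, of m j "Service m j"] sets_own by simp
  have "(\<integral>\<^sup>+\<omega>. ennreal (\<Sum>j<served D N m \<omega>. S m j \<omega>) \<partial>M) =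
      (\<integral>\<^sup>+\<omega>. (\<Sum>j. ennreal (S m j \<omega>) * indicator (A j) \<omega>) \<partial>M)"
    using AE services_nonneg
    by (intro nn_integral_cong_AE) (auto simp: sum sum_ennreal)
  also have "\<dots> = (\<Sum>j. \<integral>\<^sup>+\<omega>. ennreal (S m j \<omega>) * indicator (A j) \<omega> \<partial>M)"
    by (intro nn_integral_suminf) measurable
  also have "\<dots> = (\<Sum>j. \<integral>\<^sup>+\<omega>. ennreal (1 / mu (visited m)) * indicator (A j) \<omega> \<partial>M)"
    by (simp add: nn_integral_own_others[OF _ Sown A] service_mean nn_integral_cmult)
  also have "\<dots> = (\<integral>\<^sup>+\<omega>. (\<Sum>j. ennreal (1 / mu (visited m)) * indicator (A j) \<omega>) \<partial>M)"
    by (intro nn_integral_suminf[symmetric]) measurable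
  also have "\<dots> = (\<integral>\<^sup>+\<omega>. ennreal (1 / mu (visited m)) * ennreal (real (served D N m \<omega>)) \<partial>M)"
  proof (intro nn_integral_cong_AE, use AE in \<open>rule AE_mp\<close>, intro AE_I2 impI)
    fix \<omega> assume "\<omega> \<in> space M" "ends D N m \<omega>"
    then show "(\<Sum>j. ennreal (1 / mu (visited m)) * indicator (A j) \<omega>) =
        ennreal (1 / mu (visited m)) * ennreal (real (served D N m \<omega>))"
      unfolding sum[OF \<open>\<omega> \<in> space M\<close> \<open>ends D N m \<omega>\<close>]
      by (simp add: ennreal_of_nat_eq_real_of_nat mult.commute)
  qed
  also have "\<dots> = ennreal (1 / mu (visited m)) * (\<integral>\<^sup>+\<omega>. ennreal (real (served D N m \<omega>)) \<partial>M)"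
    using measurable_visit_M(1)[where D=D and m=m] by (intro nn_integral_cmult) simp
  finally show ?thesis .
qed

subsection \<open>Means over one visit\<close>

text \<open>The invariant of the induction over visits. It includes Wald's identity at the epoch, so
  that arrivals during the next visit can be obtained as a difference of two identities.\<close>

definition ready :: "nat \<Rightarrow> bool" where
  "ready m \<longleftrightarrow> (AE \<omega> in M. regular N m \<omega>) \<and> integrable M (epoch N m) \<and>
    (\<forall>k\<in>{1..K}. integrable M (\<lambda>\<omega>. real (content N m \<omega> k)) \<and>
      has_bochner_integral M (\<lambda>\<omega>. real (N k (epoch N m \<omega>) \<omega>)) (lam k * (\<integral>\<omega>. epoch N m \<omega> \<partial>M)))"

lemma quota_mean:
  assumes "ready m"
  shows "has_bochner_integral M (\<lambda>\<omega>. real (quota N m \<omega>))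
    (r (stage I m) * (\<integral>\<omega>. real (content N m \<omega> (visited m)) \<partial>M))"
proof -
  have r: "0 \<le> r (stage I m)" using r_bounds[OF stage_in] by auto
  have x: "integrable M (\<lambda>\<omega>. real (content N m \<omega> (visited m)))"
    using assms visited_in by (auto simp: ready_def)
  have "(\<integral>\<^sup>+\<omega>. ennreal (real (quota N m \<omega>)) \<partial>M) =
      ennreal (r (stage I m) * (\<integral>\<omega>. real (content N m \<omega> (visited m)) \<partial>M))"
    unfolding nn_integral_quota using x r by (subst nn_integral_eq_integral) (auto simp: ennreal_mult)
  then show ?thesis
    using r by (intro has_bochner_integral_nn_integral) auto
qed

lemma departure_eq: "departure D Z m \<omega> = epoch Z m \<omega> + (\<Sum>j<served D Z m \<omega>. S m j \<omega>)"
  by (simp add: departure_def completion_def)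

text \<open>The time \<open>v\<close> after the departure is 0 for the end of the visit and \<open>V m\<close> for the next epoch.\<close>

lemma visit_means:
  assumes R: "ready m" and AE: "AE \<omega> in M. ends D N m \<omega>"
    and int: "integrable M (\<lambda>\<omega>. real (served D N m \<omega>))"
    and v: "v \<in> borel_measurable M" "\<And>k. k \<in> {1..K} \<Longrightarrow> v \<in> borel_measurable (others (Arrivals k))"
    "\<And>\<omega>. \<omega> \<in> space M \<Longrightarrow> 0 \<le> v \<omega>" "integrable M v"
  defines "T \<equiv> (\<integral>\<omega>. epoch N m \<omega> \<partial>M) + (\<integral>\<omega>. real (served D N m \<omega>) \<partial>M) / mu (visited m) + (\<integral>\<omega>. v \<omega> \<partial>M)"
  shows "has_bochner_integral M (\<lambda>\<omega>. departure D N m \<omega> + v \<omega>) T"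
    and "k \<in> {1..K} \<Longrightarrow>
      has_bochner_integral M (\<lambda>\<omega>. real (N k (departure D N m \<omega> + v \<omega>) \<omega>)) (lam k * T)"
proof -
  let ?mu = "mu (visited m)"
  have mu: "0 < ?mu" using mu_pos[OF visited_in] .
  have [measurable]: "served D N m \<in> measurable M (count_space UNIV)"
    by (rule measurable_visit_M(1))
  let ?b = "\<lambda>\<omega>. \<Sum>j<served D N m \<omega>. S m j \<omega>"
  have b: "has_bochner_integral M ?b ((\<integral>\<omega>. real (served D N m \<omega>) \<partial>M) / ?mu)"
  proof (rule has_bochner_integral_nn_integral)
    show "?b \<in> borel_measurable M"
      by (rule measurable_compose_countable[where f="\<lambda>n \<omega>. \<Sum>j<n. S m j \<omega>"]) auto
    show "AE \<omega> in M. 0 \<le> ?b \<omega>" using services_nonneg by (auto intro!: sum_nonneg)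
    show "0 \<le> (\<integral>\<omega>. real (served D N m \<omega>) \<partial>M) / ?mu" using mu by simp
    have "(\<integral>\<^sup>+\<omega>. ennreal (real (served D N m \<omega>)) \<partial>M) = ennreal (\<integral>\<omega>. real (served D N m \<omega>) \<partial>M)"
      using int by (intro nn_integral_eq_integral) auto
    then show "(\<integral>\<^sup>+\<omega>. ennreal (?b \<omega>) \<partial>M) = ennreal ((\<integral>\<omega>. real (served D N m \<omega>) \<partial>M) / ?mu)"
      unfolding nn_integral_services[OF AE] using mu by (simp add: ennreal_mult[symmetric])
  qed
  have e: "integrable M (epoch N m)" using R by (simp add: ready_def)
  show T: "has_bochner_integral M (\<lambda>\<omega>. departure D N m \<omega> + v \<omega>) T"
    unfolding departure_eq T_def
    by (intro has_bochner_integral_add has_bochner_integral_integrable e b v)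
  have AE': "AE \<omega> in M. regular N m \<omega> \<and> ends D N m \<omega>"
    using R AE by (auto simp: ready_def)
  have T': "integrable M (\<lambda>\<omega>. departure D N m \<omega> + v \<omega>)" "(\<integral>\<omega>. departure D N m \<omega> + v \<omega> \<partial>M) = T"
    using T by (auto simp: has_bochner_integral_iff)
  show "has_bochner_integral M (\<lambda>\<omega>. real (N k (departure D N m \<omega> + v \<omega>) \<omega>)) (lam k * T)" if k: "k \<in> {1..K}"
    using departure_wald[OF k AE' v(2)[OF k] v(3) T'(1)] T'(2) by (simp add: has_bochner_integral_iff)
qed

section \<open>Almost sure termination and mean number of services of a visit\<close>

lemma rho_less_1: "lam (visited m) / mu (visited m) < 1"
proof -
  have "lam (visited m) / mu (visited m) \<le> (\<Sum>k=1..K. lam k / mu k)"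
    using visited_in lam_pos mu_pos by (intro member_le_sum) (auto simp: less_imp_le)
  then show ?thesis using stable by simp
qed

lemma arrivals_mono: "\<omega> \<in> space M \<Longrightarrow> k \<in> {1..K} \<Longrightarrow> 0 \<le> t \<Longrightarrow> t \<le> u \<Longrightarrow> N k t \<omega> \<le> N k u \<omega>"
  using arrivals[of k] by (auto simp: poisson_process_def mono_on_def)

text \<open>Up to the stopping level, \<open>n\<close> grows by one while the right-hand side never
  decreases, and equality before that level would have stopped the visit. So \<open>n\<close> cannot
  overtake it, even if the visit is cut off by \<open>D\<close>.\<close>

lemma served_le:
  assumes \<omega>: "\<omega> \<in> space M" and e: "ends D N m \<omega>"
  shows "served D N m \<omega> \<le> quota N m \<omega> +
    (N (visited m) (departure D N m \<omega>) \<omega> - N (visited m) (epoch N m \<omega>) \<omega>)"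
proof -
  let ?h = "visited m"
  let ?q = "\<lambda>n. quota N m \<omega> + (N ?h (completion N m n \<omega>) \<omega> - N ?h (epoch N m \<omega>) \<omega>)"
  have "n \<le> ?q n" if "n \<le> served D N m \<omega>" for n
    using that
  proof (induction n)
    case (Suc n)
    then have "n \<le> ?q n" "n \<noteq> ?q n"
      using served_least(2)[OF e, of n] by (auto simp: hit_def)
    moreover have "N ?h (completion N m n \<omega>) \<omega> \<le> N ?h (completion N m (Suc n) \<omega>) \<omega>"
      using \<omega> epoch_nonneg[OF \<omega>, of N m] epoch_le_completion[OF \<omega>, of N m n] completion_mono[OF \<omega>, of n "Suc n" N m]
      by (intro arrivals_mono visited_in) auto
    ultimately show ?case by linarith
  qed simp
  then show ?thesis by (simp add: departure_def)
qed

text \<open>Wald's identities at the departure and at the epoch are subtracted: the mean epoch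
  cancels, and \<lambda> times the mean length of the visit remains.\<close>

lemma quota_plus_arrivals_mean:
  assumes R: "ready m" and AE: "AE \<omega> in M. ends D N m \<omega>"
    and int: "integrable M (\<lambda>\<omega>. real (served D N m \<omega>))"
  shows "has_bochner_integral M
    (\<lambda>\<omega>. real (quota N m \<omega> + (N (visited m) (departure D N m \<omega>) \<omega> - N (visited m) (epoch N m \<omega>) \<omega>)))
    (r (stage I m) * (\<integral>\<omega>. real (content N m \<omega> (visited m)) \<partial>M) +
     lam (visited m) / mu (visited m) * (\<integral>\<omega>. real (served D N m \<omega>) \<partial>M))"
    (is "has_bochner_integral M ?g ?b")
proof -
  let ?h = "visited m"
  let ?E = "\<lambda>f. \<integral>\<omega>. f \<omega> \<partial>M"
  let ?e = "lam ?h * (?E (epoch N m) + ?E (\<lambda>\<omega>. real (served D N m \<omega>)) / mu ?h)"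
  \<comment> \<open>Here the delay after the departure is 0.\<close>
  have "has_bochner_integral M (\<lambda>\<omega>. real (N ?h (departure D N m \<omega> + 0) \<omega>))
      (lam ?h * (?E (epoch N m) + ?E (\<lambda>\<omega>. real (served D N m \<omega>)) / mu ?h + ?E (\<lambda>_. 0)))"
    by (rule visit_means(2)[OF R AE int _ _ _ _ visited_in]) simp_all
  then have dep: "has_bochner_integral M (\<lambda>\<omega>. real (N ?h (departure D N m \<omega>) \<omega>)) ?e"
    by simp
  have ep: "has_bochner_integral M (\<lambda>\<omega>. real (N ?h (epoch N m \<omega>) \<omega>)) (lam ?h * ?E (epoch N m))"
    using R visited_in by (simp add: ready_def)
  have "has_bochner_integral M
      (\<lambda>\<omega>. real (quota N m \<omega>) + (real (N ?h (departure D N m \<omega>) \<omega>) - real (N ?h (epoch N m \<omega>) \<omega>)))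
      (r (stage I m) * ?E (\<lambda>\<omega>. real (content N m \<omega> ?h)) + (?e - lam ?h * ?E (epoch N m)))"
    by (intro has_bochner_integral_add has_bochner_integral_diff quota_mean R dep ep)
  also have "?this \<longleftrightarrow> has_bochner_integral M ?g ?b"
  proof (rule has_bochner_integral_cong[OF refl])
    fix \<omega> assume \<omega>: "\<omega> \<in> space M"
    have "N ?h (epoch N m \<omega>) \<omega> \<le> N ?h (departure D N m \<omega>) \<omega>"
      by (intro arrivals_mono \<omega> visited_in epoch_nonneg epoch_le_departure)
    then show "real (quota N m \<omega>) + (real (N ?h (departure D N m \<omega>) \<omega>) - real (N ?h (epoch N m \<omega>) \<omega>)) = ?g \<omega>"
      by simp
  qed (simp add: algebra_simps)
  finally show ?thesis .
qed

text \<open>Taking means in \<open>served_le\<close> gives a bound containing the same mean on both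
  sides; its finiteness allows the terms to be collected. For a truncated visit only the inequality
  is available.\<close>

lemma served_mean_le:
  assumes R: "ready m" and AE: "AE \<omega> in M. ends D N m \<omega>"
    and int: "integrable M (\<lambda>\<omega>. real (served D N m \<omega>))"
  shows "(1 - lam (visited m) / mu (visited m)) * (\<integral>\<omega>. real (served D N m \<omega>) \<partial>M) \<le>
    r (stage I m) * (\<integral>\<omega>. real (content N m \<omega> (visited m)) \<partial>M)"
proof -
  note g = quota_plus_arrivals_mean[OF R AE int, unfolded has_bochner_integral_iff]
  have "(\<integral>\<omega>. real (served D N m \<omega>) \<partial>M) \<le> (\<integral>\<omega>. real (quota N m \<omega> +
      (N (visited m) (departure D N m \<omega>) \<omega> - N (visited m) (epoch N m \<omega>) \<omega>)) \<partial>M)"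
    using AE by (intro integral_mono_AE int conjunct1[OF g]) (auto dest!: served_le)
  then show ?thesis
    unfolding conjunct2[OF g] by (simp add: algebra_simps)
qed

lemma truncated_ends: "ends {J} N m \<omega>"
  by (auto simp: ends_def)

lemma served_truncated_le: "served {J} N m \<omega> \<le> J"
  unfolding served_def by (rule Least_le) simp

lemma served_truncated_eq: "\<not> ends {} N m \<omega> \<Longrightarrow> served {J} N m \<omega> = J"
  using served_least(1)[OF truncated_ends, of J m \<omega>] by (auto simp: ends_def)

lemma served_truncated_min:
  assumes "ends {} N m \<omega>"
  shows "served {J} N m \<omega> = min J (served {} N m \<omega>)"
proof -
  have "j < served {J} N m \<omega> \<longleftrightarrow> j < min J (served {} N m \<omega>)" for j
    unfolding less_served_iff[OF truncated_ends] less_served_iff[OF assms] min_less_iff_conj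
    by (auto simp: not_le)
  then show ?thesis by (metis linorder_neq_iff)
qed

text \<open>A truncated visit has at most \<open>J\<close> services, so its mean is finite a priori
  and \<open>served_mean_le\<close> applies. The point is that \<open>C\<close> does not depend on
  \<open>J\<close>.\<close>

lemma served_truncated_mean_le:
  assumes R: "ready m"
  defines "C \<equiv> r (stage I m) * (\<integral>\<omega>. real (content N m \<omega> (visited m)) \<partial>M) / (1 - lam (visited m) / mu (visited m))"
  shows "integrable M (\<lambda>\<omega>. real (served {J} N m \<omega>))" "(\<integral>\<omega>. real (served {J} N m \<omega>) \<partial>M) \<le> C"
proof -
  have [measurable]: "served {J} N m \<in> measurable M (count_space UNIV)"
    by (rule measurable_visit_M(1))
  show int: "integrable M (\<lambda>\<omega>. real (served {J} N m \<omega>))"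
    using served_truncated_le by (intro integrable_const_bound[of _ "real J"]) auto
  show "(\<integral>\<omega>. real (served {J} N m \<omega>) \<partial>M) \<le> C"
    using served_mean_le[OF R _ int] truncated_ends rho_less_1[of m]
    unfolding C_def by (subst pos_le_divide_eq) (auto simp: mult.commute)
qed

text \<open>Where the visit never ends, its truncation has exactly \<open>J\<close> services. Hence
  \<open>J\<close> times the probability of this event is at most \<open>C\<close> for all
  \<open>J\<close>, so the probability is 0.\<close>

lemma AE_ends:
  assumes R: "ready m"
  shows "AE \<omega> in M. ends {} N m \<omega>"
proof -
  define C where "C = r (stage I m) * (\<integral>\<omega>. real (content N m \<omega> (visited m)) \<partial>M) / (1 - lam (visited m) / mu (visited m))"
  note tr = served_truncated_mean_le[OF R, folded C_def]
  have [measurable]: "Measurable.pred M (ends {} N m)"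
    by (rule measurable_visit_M(3))
  let ?A = "{\<omega>\<in>space M. \<not> ends {} N m \<omega>}"
  have A: "?A \<in> sets M" by measurable
  have "real J * prob ?A \<le> C" for J
  proof -
    have "real J * prob ?A = (\<integral>\<omega>. real J * indicator ?A \<omega> \<partial>M)"
      using A by simp
    also have "\<dots> \<le> (\<integral>\<omega>. real (served {J} N m \<omega>) \<partial>M)"
      using A by (intro integral_mono tr(1) integrable_mult_right integrable_real_indicator)
        (auto simp: served_truncated_eq less_top[symmetric] split: split_indicator)
    finally show ?thesis using tr(2)[of J] by simp
  qed
  then have "\<not> 0 < prob ?A"
    using reals_Archimedean3[of "prob ?A"] not_less by blast
  then have "prob ?A = 0"
    using measure_nonneg[of M ?A] by linarith
  then show ?thesis
    using prob_eq_0[OF A] by simp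
qed

text \<open>Almost surely the truncated counts are \<open>min J (served {} N m \<omega>)\<close>;
  they increase to the full count, and monotone convergence preserves the uniform bound.\<close>

lemma served_integrable:
  assumes R: "ready m"
  shows "integrable M (\<lambda>\<omega>. real (served {} N m \<omega>))"
proof -
  define C where "C = r (stage I m) * (\<integral>\<omega>. real (content N m \<omega> (visited m)) \<partial>M) / (1 - lam (visited m) / mu (visited m))"
  note tr = served_truncated_mean_le[OF R, folded C_def]
  have [measurable]: "served D N m \<in> measurable M (count_space UNIV)" for D
    by (rule measurable_visit_M(1))
  have "(\<integral>\<^sup>+\<omega>. ennreal (real (served {} N m \<omega>)) \<partial>M) =
      (\<integral>\<^sup>+\<omega>. (SUP J. ennreal (real (min J (served {} N m \<omega>)))) \<partial>M)"
  proof (intro nn_integral_cong antisym)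
    fix \<omega>
    show "ennreal (real (served {} N m \<omega>)) \<le> (SUP J. ennreal (real (min J (served {} N m \<omega>))))"
      by (rule SUP_upper2[of "served {} N m \<omega>"]) auto
    show "(SUP J. ennreal (real (min J (served {} N m \<omega>)))) \<le> ennreal (real (served {} N m \<omega>))"
      by (intro SUP_least ennreal_leI) auto
  qed
  also have "\<dots> = (SUP J. \<integral>\<^sup>+\<omega>. ennreal (real (min J (served {} N m \<omega>))) \<partial>M)"
    by (intro nn_integral_monotone_convergence_SUP) (auto simp: incseq_def le_fun_def intro!: ennreal_leI)
  also have "\<dots> \<le> ennreal C"
  proof (rule SUP_least)
    fix J
    have "(\<integral>\<^sup>+\<omega>. ennreal (real (min J (served {} N m \<omega>))) \<partial>M) = (\<integral>\<^sup>+\<omega>. ennreal (real (served {J} N m \<omega>)) \<partial>M)"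
      using AE_ends[OF R] by (intro nn_integral_cong_AE) (auto simp: served_truncated_min)
    also have "\<dots> = ennreal (\<integral>\<omega>. real (served {J} N m \<omega>) \<partial>M)"
      using tr(1) by (intro nn_integral_eq_integral) auto
    also have "\<dots> \<le> ennreal C" using tr(2) by (intro ennreal_leI)
    finally show "(\<integral>\<^sup>+\<omega>. ennreal (real (min J (served {} N m \<omega>))) \<partial>M) \<le> ennreal C" .
  qed
  finally have "(\<integral>\<^sup>+\<omega>. ennreal (real (served {} N m \<omega>)) \<partial>M) < \<infinity>"
    by (rule le_less_trans) simp
  then show ?thesis
    by (intro integrableI_nonneg) auto
qed

section \<open>Recursion for the means from one epoch to the next\<close>

lemma epoch_mean_Suc:
  assumes R: "ready m"
  defines "T \<equiv> (\<integral>\<omega>. epoch N m \<omega> \<partial>M) + (\<integral>\<omega>. real (served {} N m \<omega>) \<partial>M) / mu (visited m) + s (stage I m)"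
  shows "has_bochner_integral M (epoch N (Suc m)) T"
    and "k \<in> {1..K} \<Longrightarrow> has_bochner_integral M (\<lambda>\<omega>. real (N k (epoch N (Suc m) \<omega>) \<omega>)) (lam k * T)"
proof -
  have V: "V m \<in> borel_measurable (others (Arrivals k))" for k
    by (intro measurable_switchover space_others source_sets_subset_others) auto
  note vm = visit_means[OF R AE_ends[OF R] served_integrable[OF R] measurable_switchover_M V switchovers_nonneg
      switchover_mean(1), unfolded switchover_mean(2), folded T_def epoch_Suc]
  show "has_bochner_integral M (epoch N (Suc m)) T" by (rule vm(1))
  show "k \<in> {1..K} \<Longrightarrow> has_bochner_integral M (\<lambda>\<omega>. real (N k (epoch N (Suc m) \<omega>) \<omega>)) (lam k * T)"
    by (rule vm(2))
qed

lemma served_eq: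
  assumes "ends {} N m \<omega>"
  shows "served {} N m \<omega> = quota N m \<omega> +
    (N (visited m) (departure {} N m \<omega>) \<omega> - N (visited m) (epoch N m \<omega>) \<omega>)"
  using served_least(1)[OF assms] by (simp add: hit_def departure_def)

text \<open>Without truncation the visit almost surely ends at its level, so the inequality of
  \<open>served_mean_le\<close> becomes an equality.\<close>

lemma served_mean:
  assumes R: "ready m"
  shows "(1 - lam (visited m) / mu (visited m)) * (\<integral>\<omega>. real (served {} N m \<omega>) \<partial>M) =
    r (stage I m) * (\<integral>\<omega>. real (content N m \<omega> (visited m)) \<partial>M)"
proof -
  note g = quota_plus_arrivals_mean[OF R AE_ends[OF R] served_integrable[OF R], unfolded has_bochner_integral_iff]
  have "(\<integral>\<omega>. real (served {} N m \<omega>) \<partial>M) = (\<integral>\<omega>. real (quota N m \<omega> +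
      (N (visited m) (departure {} N m \<omega>) \<omega> - N (visited m) (epoch N m \<omega>) \<omega>)) \<partial>M)"
  proof (rule integral_cong_AE)
    show "AE \<omega> in M. real (served {} N m \<omega>) = real (quota N m \<omega> +
        (N (visited m) (departure {} N m \<omega>) \<omega> - N (visited m) (epoch N m \<omega>) \<omega>))"
      using AE_ends[OF R] by eventually_elim (simp only: served_eq)
  qed (use served_integrable[OF R] conjunct1[OF g] in auto)
  then show ?thesis
    unfolding conjunct2[OF g] by (simp add: algebra_simps)
qed

text \<open>The recursion subtracts naturals, with truncation. Almost surely the departures are the
  selected customers, at most those found, plus the arrivals during the visit, so nothing is
  truncated and the balance holds over the reals.\<close>

lemma content_balance:
  assumes R: "ready m" and k: "k \<in> {1..K}"
  shows "AE \<omega> in M. real (content N (Suc m) \<omega> k) = real (content N m \<omega> k) +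
    real (N k (epoch N (Suc m) \<omega>) \<omega>) - real (N k (epoch N m \<omega>) \<omega>) -
    (if k = visited m then real (served {} N m \<omega>) else 0)"
  using AE_ends[OF R] AE_quota_le[of m]
proof (rule AE_mp[OF AE_conjI], intro AE_I2 impI)
  fix \<omega> assume \<omega>: "\<omega> \<in> space M" and *: "ends {} N m \<omega> \<and> quota N m \<omega> \<le> content N m \<omega> (visited m)"
  have dep: "N k (epoch N m \<omega>) \<omega> \<le> N k (departure {} N m \<omega>) \<omega>"
    by (intro arrivals_mono \<omega> k epoch_nonneg epoch_le_departure)
  have "0 \<le> departure {} N m \<omega>"
    using epoch_nonneg[OF \<omega>, of N m] epoch_le_departure[OF \<omega>, of N m "{}"] by linarith
  then have ep: "N k (departure {} N m \<omega>) \<omega> \<le> N k (epoch N (Suc m) \<omega>) \<omega>"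
    by (intro arrivals_mono \<omega> k departure_le_epoch)
  show "real (content N (Suc m) \<omega> k) = real (content N m \<omega> k) +
    real (N k (epoch N (Suc m) \<omega>) \<omega>) - real (N k (epoch N m \<omega>) \<omega>) -
    (if k = visited m then real (served {} N m \<omega>) else 0)"
  proof (cases "k = visited m")
    case True
    then have "served {} N m \<omega> \<le> content N m \<omega> k + (N k (epoch N (Suc m) \<omega>) \<omega> - N k (epoch N m \<omega>) \<omega>)"
      using served_eq[of m \<omega>] conjunct1[OF *] conjunct2[OF *] dep ep unfolding True by linarith
    then show ?thesis
      using dep ep True by (simp add: content_Suc)
  next
    case False
    then show ?thesis
      using dep ep by (simp add: content_Suc)
  qed
qed

lemma content_mean_Suc:
  assumes R: "ready m" and k: "k \<in> {1..K}"
  shows "has_bochner_integral M (\<lambda>\<omega>. real (content N (Suc m) \<omega> k))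
    ((\<integral>\<omega>. real (content N m \<omega> k) \<partial>M) +
     lam k * ((\<integral>\<omega>. real (served {} N m \<omega>) \<partial>M) / mu (visited m) + s (stage I m)) -
     (if k = visited m then (\<integral>\<omega>. real (served {} N m \<omega>) \<partial>M) else 0))"
proof -
  let ?E = "\<lambda>f. \<integral>\<omega>. f \<omega> \<partial>M"
  let ?g = "\<lambda>\<omega>. real (content N m \<omega> k) + real (N k (epoch N (Suc m) \<omega>) \<omega>) - real (N k (epoch N m \<omega>) \<omega>) -
    (if k = visited m then real (served {} N m \<omega>) else 0)"
  have c: "has_bochner_integral M (\<lambda>\<omega>. real (content N m \<omega> k)) (?E (\<lambda>\<omega>. real (content N m \<omega> k)))"
    and ep: "has_bochner_integral M (\<lambda>\<omega>. real (N k (epoch N m \<omega>) \<omega>)) (lam k * ?E (epoch N m))"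
    using R k by (auto simp: ready_def has_bochner_integral_iff)
  have n: "has_bochner_integral M (\<lambda>\<omega>. if k = visited m then real (served {} N m \<omega>) else 0)
      (if k = visited m then ?E (\<lambda>\<omega>. real (served {} N m \<omega>)) else 0)"
    using served_integrable[OF R] by (cases "k = visited m") (auto simp: has_bochner_integral_iff)
  note g = has_bochner_integral_diff[OF has_bochner_integral_diff[OF
      has_bochner_integral_add[OF c epoch_mean_Suc(2)[OF R k]] ep] n]
  have [measurable]: "(\<lambda>\<omega>. content N (Suc m) \<omega> k) \<in> measurable M (count_space UNIV)"
    by (rule measurable_state_M(2)[OF k])
  have "has_bochner_integral M (\<lambda>\<omega>. real (content N (Suc m) \<omega> k)) b \<longleftrightarrow> has_bochner_integral M ?g b" for b
    using borel_measurable_has_bochner_integral[OF g] content_balance[OF R k]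
    by (intro has_bochner_integral_cong_AE) auto
  then show ?thesis
    using g by (simp add: algebra_simps)
qed

lemma ready_Suc:
  assumes R: "ready m"
  shows "ready (Suc m)"
proof -
  have "AE \<omega> in M. regular N (Suc m) \<omega>"
    using R AE_ends[OF R] by (auto simp: ready_def regular_Suc)
  then show ?thesis
    using epoch_mean_Suc[OF R] content_mean_Suc[OF R]
    by (auto simp: ready_def has_bochner_integral_iff)
qed

text \<open>Let \<open>n\<close> be the mean number of services, so
  \<open>(1 - \<rho>) * n = r i * x m h\<close>. At the visited queue, arrivals during the visit
  contribute \<open>\<rho> * n\<close> and departures \<open>- n\<close>, whence \<rho> disappears;
  at another queue only the arrivals during the mean visit length \<open>n / mu h\<close>
  remain.\<close>

lemma mean_step:
  fixes m :: nat
  assumes R: "ready m" and k: "k \<in> {1..K}"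
  defines "x \<equiv> \<lambda>m k. \<integral>\<omega>. real (content N m \<omega> k) \<partial>M" and "i \<equiv> stage I m" and "h \<equiv> visited m"
  shows "k = h \<Longrightarrow> x (Suc m) k = s i * lam k + (1 - r i) * x m k"
    and "k \<noteq> h \<Longrightarrow> x (Suc m) k = s i * lam k + x m k +
      x m h * r i * lam k * (1 / (mu h * (1 - lam h / mu h)))"
proof -
  define n where "n = (\<integral>\<omega>. real (served {} N m \<omega>) \<partial>M)"
  define \<rho> where "\<rho> = lam h / mu h"
  have mu: "0 < mu h" unfolding h_def by (rule mu_pos[OF visited_in])
  have \<rho>: "\<rho> < 1" unfolding h_def \<rho>_def by (rule rho_less_1)
  have n: "(1 - \<rho>) * n = r i * x m h"
    using served_mean[OF R] by (simp add: n_def \<rho>_def h_def i_def x_def)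
  have x: "x (Suc m) k = x m k + lam k * (n / mu h + s i) - (if k = h then n else 0)"
    using content_mean_Suc[OF R k] by (simp add: n_def h_def i_def x_def has_bochner_integral_iff)
  show "x (Suc m) k = s i * lam k + (1 - r i) * x m k" if "k = h"
  proof -
    have "lam k * (n / mu h) = \<rho> * n" using that by (simp add: \<rho>_def)
    then show ?thesis using x n that by (simp add: algebra_simps)
  qed
  have "n = r i * x m h / (1 - \<rho>)"
    using n \<rho> by (simp add: field_simps)
  then show "x (Suc m) k = s i * lam k + x m k + x m h * r i * lam k * (1 / (mu h * (1 - lam h / mu h)))"
    if "k \<noteq> h"
    using x that unfolding \<rho>_def[symmetric] by (simp add: algebra_simps)
qed

lemma ready_0:
  assumes "\<And>k. k \<in> {1..K} \<Longrightarrow> integrable M (\<lambda>\<omega>. real (Q0 k \<omega>))"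
  shows "ready 0"
proof -
  have "has_bochner_integral M (\<lambda>\<omega>. real (N k (epoch N 0 \<omega>) \<omega>)) (lam k * (\<integral>\<omega>. epoch N 0 \<omega> \<partial>M))"
    if "k \<in> {1..K}" for k
  proof -
    have "has_bochner_integral M (\<lambda>\<omega>. real (N k (epoch N 0 \<omega>) \<omega>)) 0 \<longleftrightarrow> has_bochner_integral M (\<lambda>_. 0::real) 0"
      using arrivals[OF that] by (intro has_bochner_integral_cong) (auto simp: epoch_0 poisson_process_def)
    then show ?thesis by (simp add: epoch_0 has_bochner_integral_zero)
  qed
  then show ?thesis
    using assms by (auto simp: ready_def regular_def epoch_0[abs_def] content_0)
qed

section \<open>Stationarity over a cycle\<close>

lemma queue_at_epoch_eq: "queue_at_epoch I p N S V Y Q0 c i k \<omega> = content N (c * I + (i - 1)) \<omega> k"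
  by (simp add: queue_at_epoch_def content_def)

text \<open>Stationarity equates laws of restricted queue-length vectors, and the mean of one
  coordinate is an integral with respect to such a law.\<close>

lemma steady_state_cycle_mean:
  assumes st: "steady_state M K I p N S V Y Q0" and k: "k \<in> {1..K}"
  shows "(\<integral>\<omega>. real (content N (c * I) \<omega> k) \<partial>M) = (\<integral>\<omega>. real (Q0 k \<omega>) \<partial>M)"
proof -
  let ?P = "PiM {1..K} (\<lambda>_. count_space (UNIV :: nat set))"
  have mean: "(\<integral>f. real (f k) \<partial>distr M ?P (\<lambda>\<omega>. \<lambda>j\<in>{1..K}. X j \<omega>)) = (\<integral>\<omega>. real (X k \<omega>) \<partial>M)"
    if "\<And>j. j \<in> {1..K} \<Longrightarrow> X j \<in> measurable M (count_space UNIV)" for X :: "nat \<Rightarrow> 'a \<Rightarrow> nat"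
  proof -
    have "(\<lambda>\<omega>. \<lambda>j\<in>{1..K}. X j \<omega>) \<in> measurable M ?P"
      using that by (rule measurable_restrict)
    moreover have "(\<lambda>f. real (f k)) \<in> borel_measurable ?P"
      using k by measurable
    ultimately show ?thesis
      using k by (subst integral_distr) auto
  qed
  have "distr M ?P (\<lambda>\<omega>. \<lambda>k\<in>{1..K}. content N (c * I) \<omega> k) = distr M ?P (\<lambda>\<omega>. \<lambda>k\<in>{1..K}. Q0 k \<omega>)"
    using st by (simp add: steady_state_def queue_at_epoch_eq)
  then show ?thesis
    using mean[of "\<lambda>j \<omega>. content N (c * I) \<omega> j"] mean[of Q0] measurable_state_M(2) initial by simp
qed

subsection \<open>Uniqueness\<close>

lemma next_stage_bij: "bij_betw (next_stage I) {1..I} {1..I}"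
proof -
  have "inj_on (next_stage I) {1..I}"
    by (auto simp: inj_on_def next_stage_def split: if_splits)
  moreover have "next_stage I ` {1..I} \<subseteq> {1..I}"
    using I_pos by (auto simp: next_stage_def)
  ultimately show ?thesis
    by (simp add: bij_betw_def endo_inj_surj)
qed

lemma mean_queue_equations_unique:
  assumes q: "mean_queue_equations K I p lam mu s r q" and q': "mean_queue_equations K I p lam mu s r q'"
    and k: "k \<in> {1..K}" and i: "i \<in> {1..I}"
  shows "q' k i = q k i"
proof -
  define d where "d k i = q' k i - q k i" for k i
  \<comment> \<open>The expression for the mean visit length, with \<open>d\<close> in place of the
    mean queue lengths; it may be negative.\<close>
  define \<theta> where "\<theta> i = d (p i) i * r i * (1 / (mu (p i) * (1 - lam (p i) / mu (p i))))" for i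
  define \<rho> where "\<rho> = (\<Sum>k=1..K. lam k / mu k)"
  \<comment> \<open>Weights \<open>1 / mu k\<close> turn customers into work, the unit in which
    arrivals during a visit add up to the total load.\<close>
  define F where "F i = (\<Sum>k=1..K. \<bar>d k i\<bar> / mu k)" for i
  have d_visited: "d k (next_stage I i) = (1 - r i) * d k i" if "k \<in> {1..K}" "i \<in> {1..I}" "k = p i" for k i
    using q q' that unfolding mean_queue_equations_def d_def by (simp add: algebra_simps)
  have d_other: "d k (next_stage I i) = d k i + lam k * \<theta> i" if "k \<in> {1..K}" "i \<in> {1..I}" "k \<noteq> p i" for k i
  proof -
    define c where "c = 1 / (mu (p i) * (1 - lam (p i) / mu (p i)))"
    have "q k (next_stage I i) = s i * lam k + q k i + q (p i) i * r i * lam k * c"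
      "q' k (next_stage I i) = s i * lam k + q' k i + q' (p i) i * r i * lam k * c"
      using q q' that unfolding mean_queue_equations_def c_def by blast+
    then show ?thesis
      unfolding \<theta>_def c_def[symmetric] d_def by (simp add: algebra_simps)
  qed
  have gap: "0 < mu (p i) - lam (p i)" if "i \<in> {1..I}" for i
  proof -
    have "lam (p i) / mu (p i) \<le> (\<Sum>k=1..K. lam k / mu k)"
      using table[OF that] lam_pos mu_pos by (intro member_le_sum) (auto simp: less_imp_le)
    then have "lam (p i) / mu (p i) < 1" using stable by simp
    then show ?thesis using mu_pos[OF table[OF that]] by (simp add: divide_less_eq)
  qed
  have rd: "r i * \<bar>d (p i) i\<bar> = \<bar>\<theta> i\<bar> * (mu (p i) - lam (p i))" if "i \<in> {1..I}" for i
  proof -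
    have "mu (p i) * (1 - lam (p i) / mu (p i)) = mu (p i) - lam (p i)"
      using mu_pos[OF table[OF that]] by (simp add: field_simps)
    then show ?thesis
      using gap[OF that] r_bounds[OF that] by (simp add: \<theta>_def abs_mult)
  qed
  \<comment> \<open>At the visited queue this is an equality because \<open>1 - r i\<close> is
    nonnegative; elsewhere it is the triangle inequality.\<close>
  have visit: "\<bar>d k (next_stage I i)\<bar> / mu k \<le>
      \<bar>d k i\<bar> / mu k + lam k / mu k * \<bar>\<theta> i\<bar> - (if k = p i then \<bar>\<theta> i\<bar> else 0)"
    if "k \<in> {1..K}" "i \<in> {1..I}" for k i
  proof (cases "k = p i")
    case True
    have mu: "0 < mu k" using mu_pos that by blast
    have "\<bar>d k (next_stage I i)\<bar> = (1 - r i) * \<bar>d k i\<bar>"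
      using d_visited[OF that True] r_bounds[OF that(2)] by (simp add: abs_mult)
    also have "\<dots> = \<bar>d k i\<bar> - \<bar>\<theta> i\<bar> * (mu k - lam k)"
      using rd[OF that(2)] True by (simp add: algebra_simps)
    finally show ?thesis using mu True by (simp add: field_simps)
  next
    case False
    have mu: "0 < mu k" using mu_pos that by blast
    have "\<bar>d k (next_stage I i)\<bar> \<le> \<bar>d k i\<bar> + lam k * \<bar>\<theta> i\<bar>"
      using d_other[OF that False] abs_triangle_ineq[of "d k i" "lam k * \<theta> i"] lam_pos[OF that(1)]
      by (simp add: abs_mult)
    then have "\<bar>d k (next_stage I i)\<bar> / mu k \<le> (\<bar>d k i\<bar> + lam k * \<bar>\<theta> i\<bar>) / mu k"
      using mu by (intro divide_right_mono) auto
    then show ?thesis using False by (simp add: add_divide_distrib)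
  qed
  \<comment> \<open>Arrivals at all queues add at most
    \<open>\<rho> * \<bar>\<theta> i\<bar>\<close> in total, and the visited queue contributes the
    loss \<open>\<bar>\<theta> i\<bar>\<close>.\<close>
  have F: "F (next_stage I i) \<le> F i - (1 - \<rho>) * \<bar>\<theta> i\<bar>" if "i \<in> {1..I}" for i
  proof -
    have "F (next_stage I i) \<le>
        (\<Sum>k=1..K. \<bar>d k i\<bar> / mu k + lam k / mu k * \<bar>\<theta> i\<bar> - (if k = p i then \<bar>\<theta> i\<bar> else 0))"
      unfolding F_def by (intro sum_mono visit that)
    also have "\<dots> = F i + \<rho> * \<bar>\<theta> i\<bar> - \<bar>\<theta> i\<bar>"
      using table[OF that]
      by (simp add: sum.distrib sum_subtractf F_def \<rho>_def sum_distrib_right)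
    finally show ?thesis by (simp add: algebra_simps)
  qed
  \<comment> \<open>Summed around the cycle, the values of \<open>F\<close> cancel and only the
    nonnegative losses remain.\<close>
  have "(\<Sum>i=1..I. F (next_stage I i)) = (\<Sum>i=1..I. F i)"
    by (rule sum.reindex_bij_betw[OF next_stage_bij])
  then have "(1 - \<rho>) * (\<Sum>i=1..I. \<bar>\<theta> i\<bar>) \<le> 0"
    using sum_mono[of "{1..I}" "\<lambda>i. F (next_stage I i)" "\<lambda>i. F i - (1 - \<rho>) * \<bar>\<theta> i\<bar>"] F
    by (simp add: sum_subtractf sum_distrib_left)
  then have "(\<Sum>i=1..I. \<bar>\<theta> i\<bar>) \<le> 0"
    using stable by (simp add: \<rho>_def mult_le_0_iff)
  then have "(\<Sum>i=1..I. \<bar>\<theta> i\<bar>) = 0"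
    by (intro antisym sum_nonneg) auto
  then have \<theta>: "\<theta> i = 0" if "i \<in> {1..I}" for i
    using that by (subst (asm) sum_nonneg_eq_0_iff) auto
  have rd0: "r i * d (p i) i = 0" if "i \<in> {1..I}" for i
    using rd[OF that] \<theta>[OF that] by simp
  have d_next: "d k (next_stage I i) = d k i" if "i \<in> {1..I}" for i
    using d_visited[OF k that] d_other[OF k that] rd0[OF that] \<theta>[OF that]
    by (cases "k = p i") (auto simp: algebra_simps)
  have d_1: "d k i = d k 1" if "i \<in> {1..I}" for i
    using that
  proof (induction i)
    case (Suc i)
    then show ?case
      using d_next[of i] by (cases "i = 0") (auto simp: next_stage_def)
  qed simp
  have "\<exists>j\<in>{i. i \<in> {1..I} \<and> p i = k}. 0 < r j"
    using r_queue[OF k] by (meson not_less sum_nonpos)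
  then obtain j where j: "j \<in> {1..I}" "p j = k" "0 < r j" by auto
  then have "d k j = 0" using rd0[OF j(1)] by simp
  then have "d k i = 0" using d_1[OF i] d_1[OF j(1)] by simp
  then show ?thesis by (simp add: d_def)
qed

end

section \<open>The equations for the steady-state means\<close>

theorem theorem5p1:
  fixes M :: "'a measure"
    and K I c :: nat
    and p :: "nat \<Rightarrow> nat"
    and lam mu s r :: "nat \<Rightarrow> real"
    and B W :: "nat \<Rightarrow> real measure"
    and N :: "nat \<Rightarrow> real \<Rightarrow> 'a \<Rightarrow> nat"
    and S :: "nat \<Rightarrow> nat \<Rightarrow> 'a \<Rightarrow> real"
    and V :: "nat \<Rightarrow> 'a \<Rightarrow> real"
    and Y :: "nat \<Rightarrow> nat \<Rightarrow> 'a \<Rightarrow> nat"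
    and Q0 :: "nat \<Rightarrow> 'a \<Rightarrow> nat"
    and q :: "nat \<Rightarrow> nat \<Rightarrow> real"
  assumes "bep_polling_system M K I p lam mu B s W r N S V Y Q0"
    and "steady_state M K I p N S V Y Q0"
    and "\<And>k i. k \<in> {1..K} \<Longrightarrow> i \<in> {1..I} \<Longrightarrow>
           q k i = (\<integral>\<omega>. real (queue_at_epoch I p N S V Y Q0 c i k \<omega>) \<partial>M)"
  shows "(\<forall>k\<in>{1..K}. \<forall>i\<in>{1..I}.
            integrable M (\<lambda>\<omega>. real (queue_at_epoch I p N S V Y Q0 c i k \<omega>))) \<and>
         mean_queue_equations K I p lam mu s r q \<and>
         (\<forall>q'. mean_queue_equations K I p lam mu s r q' \<longrightarrow>
            (\<forall>k\<in>{1..K}. \<forall>i\<in>{1..I}. q' k i = q k i))"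
proof -
  interpret bep_polling_system M K I p lam mu B s W r N S V Y Q0 by fact
  note st = \<open>steady_state M K I p N S V Y Q0\<close>
  define x where "x m k = (\<integral>\<omega>. real (content N m \<omega> k) \<partial>M)" for m k
  have q: "q k i = x (c * I + (i - 1)) k" if "k \<in> {1..K}" "i \<in> {1..I}" for k i
    using assms(3)[OF that] by (simp add: queue_at_epoch_eq x_def)
  have R: "ready m" for m
  proof (induction m)
    case 0
    then show ?case using st by (intro ready_0) (simp add: steady_state_def)
  qed (rule ready_Suc)
  have "integrable M (\<lambda>\<omega>. real (queue_at_epoch I p N S V Y Q0 c i k \<omega>))" if "k \<in> {1..K}" for k i
    unfolding queue_at_epoch_eq using R that by (simp add: ready_def)
  moreover have eqs: "mean_queue_equations K I p lam mu s r q"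
    unfolding mean_queue_equations_def
  proof (intro ballI)
    fix k i assume k: "k \<in> {1..K}" and i: "i \<in> {1..I}"
    \<comment> \<open>Visits are numbered from 0 and stages from 1, hence the shift.\<close>
    define m where "m = c * I + (i - 1)"
    have "m mod I = (i - 1) mod I"
      unfolding m_def by (rule mod_mult_self3)
    also have "\<dots> = i - 1"
      using i by (intro mod_less) auto
    finally have "m mod I = i - 1" .
    then have stage: "stage I m = i" and h: "visited m = p i"
      using i by (simp_all add: stage_def visited_def)
    \<comment> \<open>Within a cycle the next stage is visit \<open>m + 1\<close>. After stage
      \<open>I\<close>, visit \<open>m + 1\<close> opens cycle \<open>c + 1\<close>, and
      stationarity identifies its means with those at stage 1 of cycle \<open>c\<close>.\<close>
    have q_next: "q k (next_stage I i) = x (Suc m) k"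
    proof (cases "i = I")
      case True
      have "Suc m = Suc c * I" using I_pos True by (simp add: m_def)
      then have "x (Suc m) k = x (c * I) k"
        unfolding x_def by (simp only: steady_state_cycle_mean[OF st k])
      then show ?thesis using q[OF k, of 1] True I_pos by (simp add: next_stage_def)
    next
      case False
      then have "q k (i + 1) = x (c * I + i) k" using q[OF k, of "i + 1"] i by simp
      then show ?thesis using False i by (simp add: next_stage_def m_def)
    qed
    have q_m: "q k i = x m k" "q (p i) i = x m (p i)"
      using q[OF k i] q[OF table[OF i] i] by (simp_all add: m_def)
    show "(k = p i \<longrightarrow> q k (next_stage I i) = s i * lam k + (1 - r i) * q k i) \<and>
        (k \<noteq> p i \<longrightarrow> q k (next_stage I i) = s i * lam k + q k i +
             q (p i) i * r i * lam k * (1 / (mu (p i) * (1 - lam (p i) / mu (p i)))))"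
      unfolding q_next q_m using mean_step[OF R[of m] k] unfolding stage h x_def by blast
  qed
  ultimately show ?thesis
    using mean_queue_equations_unique[OF eqs] by blast
qed

end
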